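(* Let $n,k,r$ be positive integers and let $T$ be a tree of order $n$ with $k$ pendent paths of length $r$ having minimum Mostar index among all such trees. (i) If $k=1$ and $2\le r\le n-3$, then $T\cong A^1_{n,1,2}$. (ii) If $k=2$ and $1\le r\le n-2$, then $T\cong P_n$. (iii) If $k\ge 3$ and $1\le r\le \frac{n-2}{k}$, then $T\cong A^r_{n,\lceil\frac{k}{2}\rceil,\lfloor\frac{k}{2}\rfloor}$.
   Context: For a connected simple graph $G$, the Mostar index is $Mo(G)=\sum_{uv\in E(G)}|n_u-n_v|$, where for an edge $e=uv$, $n_u$ is the number of vertices of $G$ closer (in graph distance) to $u$ than to $v$, and $n_v$ is the number of vertices closer to $v$ than to $u$. The order of a graph is its number of vertices. $P_m$ is the path on $m$ vertices. A path $u_0u_1\cdots u_r$ with $r\ge1$ in a graph $G$ is called a pendent path of length $r$ at $u_r$ if $d_G(u_0)=1$, $d_G(u_r)\ge 2$ and, when $r\ge 2$, $d_G(u_i)=2$ for $1\le i\le r-1$. (Note that $u_r$ may have degree exactly $2$; e.g. $P_n$ has two pendent paths of length $r$ for each $2\le r\le n-2$.) "With $k$ pendent paths of length $r$" means that the number of pendent paths of length $r$ is exactly $k$. For positive integers $n,r,a,b$ with $(a+b)r\le n-2$, $A^r_{n,a,b}$ is the $n$-vertex tree obtained from the path $P_m=v_1v_2\dots v_m$ with $m=n-(a+b)r$ by attaching $a$ paths of length $r$ at $v_1$ and $b$ paths of length $r$ at $v_m$ (each attached path contributes $r$ new vertices). *)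

theory Defs
  imports Complex_Main
begin

record 'a graph =
  verts :: "'a set"
  edges :: "'a set set"

definition simple_graph :: "'a graph \<Rightarrow> bool" where
  "simple_graph G \<longleftrightarrow> finite (verts G) \<and> (\<forall>e\<in>edges G. e \<subseteq> verts G \<and> card e = 2)"

definition order :: "'a graph \<Rightarrow> nat" where
  "order G = card (verts G)"

definition degree :: "'a graph \<Rightarrow> 'a \<Rightarrow> nat" where
  "degree G v = card {e \<in> edges G. v \<in> e}"

(* A walk is given by its vertex sequence, so a walk of length l is a list of length l + 1. *)
definition graph_walk :: "'a graph \<Rightarrow> 'a list \<Rightarrow> bool" where
  "graph_walk G us \<longleftrightarrow>
     us \<noteq> [] \<and> set us \<subseteq> verts G \<and> successively (\<lambda>u v. {u, v} \<in> edges G) us"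

definition graph_path :: "'a graph \<Rightarrow> 'a list \<Rightarrow> bool" where
  "graph_path G us \<longleftrightarrow> graph_walk G us \<and> distinct us"

definition graph_cycle :: "'a graph \<Rightarrow> 'a list \<Rightarrow> bool" where
  "graph_cycle G us \<longleftrightarrow> graph_path G us \<and> length us \<ge> 3 \<and> {last us, hd us} \<in> edges G"

definition graph_connected :: "'a graph \<Rightarrow> bool" where
  "graph_connected G \<longleftrightarrow>
     (\<forall>u\<in>verts G. \<forall>v\<in>verts G. \<exists>us. graph_walk G us \<and> hd us = u \<and> last us = v)"

definition is_tree :: "'a graph \<Rightarrow> bool" where
  "is_tree G \<longleftrightarrow>
     simple_graph G \<and> verts G \<noteq> {} \<and> graph_connected G \<and> \<not> (\<exists>us. graph_cycle G us)"

(* Meaningful only when v is reachable from u; it is used here for connected graphs. *)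
definition graph_dist :: "'a graph \<Rightarrow> 'a \<Rightarrow> 'a \<Rightarrow> nat" where
  "graph_dist G u v =
     (LEAST l. \<exists>us. graph_walk G us \<and> hd us = u \<and> last us = v \<and> length us = Suc l)"

definition num_closer :: "'a graph \<Rightarrow> 'a \<Rightarrow> 'a \<Rightarrow> nat" where
  "num_closer G u v = card {w \<in> verts G. graph_dist G w u < graph_dist G w v}"

(* Edges are unordered; the contribution |n_u - n_v| is symmetric in u and v, so it is
   well defined for the edge {u, v}: see edge_contribution_eq. *)
definition edge_contribution :: "'a graph \<Rightarrow> 'a set \<Rightarrow> int" where
  "edge_contribution G e =
     (THE c. \<exists>u v. e = {u, v} \<and> c = \<bar>int (num_closer G u v) - int (num_closer G v u)\<bar>)"

definition mostar_index :: "'a graph \<Rightarrow> int" where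
  "mostar_index G = (\<Sum>e\<in>edges G. edge_contribution G e)"

lemma edge_contribution_eq:
  "edge_contribution G {u, v} = \<bar>int (num_closer G u v) - int (num_closer G v u)\<bar>"
  unfolding edge_contribution_def
  by (rule the_equality) (auto simp: doubleton_eq_iff)

(* A pendent path is listed starting from its end vertex of degree 1. Since the other end has
   degree at least 2, each pendent path is represented by exactly one list. *)
definition pendent_paths :: "'a graph \<Rightarrow> nat \<Rightarrow> 'a list set" where
  "pendent_paths G r =
     {us. 1 \<le> r \<and> graph_path G us \<and> length us = Suc r \<and>
          degree G (us ! 0) = 1 \<and> degree G (us ! r) \<ge> 2 \<and>
          (r \<ge> 2 \<longrightarrow> (\<forall>i\<in>{1..r - 1}. degree G (us ! i) = 2))}"

(* Fixing the vertex type loses no generality when minimising over this class: as soon as it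
   contains one tree, the type has at least n elements, so every tree of order n with k pendent
   paths of length r occurs in the class up to isomorphism. *)
definition trees_with_pendent_paths :: "nat \<Rightarrow> nat \<Rightarrow> nat \<Rightarrow> 'a graph set" where
  "trees_with_pendent_paths n k r =
     {G. is_tree G \<and> order G = n \<and> card (pendent_paths G r) = k}"

definition graph_iso :: "'a graph \<Rightarrow> 'b graph \<Rightarrow> bool" (infix "\<cong>\<^sub>g" 50) where
  "G \<cong>\<^sub>g H \<longleftrightarrow>
     (\<exists>f. bij_betw f (verts G) (verts H) \<and>
          (\<forall>u\<in>verts G. \<forall>v\<in>verts G. {u, v} \<in> edges G \<longleftrightarrow> {f u, f v} \<in> edges H))"

definition path_graph :: "nat \<Rightarrow> nat graph" where
  "path_graph m = \<lparr>verts = {1..m}, edges = {{i, Suc i} | i. 1 \<le> i \<and> Suc i \<le> m}\<rparr>"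

(* Spine i is the vertex v_i of the path v_1 ... v_m; Branch i j is the j-th vertex, counted
   from the spine, of the i-th attached path. *)
datatype bvertex = Spine nat | Branch nat nat

(* The attached paths 1, ..., a start at v_1 and the attached paths a + 1, ..., a + b at v_m.
   The definition is intended for (a + b) * r + 2 \<le> n only. *)
definition A_graph :: "nat \<Rightarrow> nat \<Rightarrow> nat \<Rightarrow> nat \<Rightarrow> bvertex graph" where
  "A_graph r n a b =
     (let m = n - (a + b) * r in
      \<lparr>verts = Spine ` {1..m} \<union> {Branch i j | i j. i \<in> {1..a + b} \<and> j \<in> {1..r}},
       edges = {{Spine i, Spine (Suc i)} | i. 1 \<le> i \<and> Suc i \<le> m}
             \<union> {{Branch i j, Branch i (Suc j)} | i j. i \<in> {1..a + b} \<and> 1 \<le> j \<and> Suc j \<le> r}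
             \<union> {{Spine 1, Branch i 1} | i. i \<in> {1..a}}
             \<union> {{Spine m, Branch i 1} | i. i \<in> {a + 1..a + b}}\<rparr>)"

lemma simple_graph_path_graph: "simple_graph (path_graph m)"
  by (auto simp: simple_graph_def path_graph_def card_insert_if)

lemma order_path_graph: "order (path_graph m) = m"
  by (simp add: order_def path_graph_def)

lemma verts_A_graph:
  "verts (A_graph r n a b) =
     Spine ` {1..n - (a + b) * r} \<union> (\<lambda>(i, j). Branch i j) ` ({1..a + b} \<times> {1..r})"
  by (auto simp: A_graph_def Let_def)

lemma order_A_graph:
  assumes "(a + b) * r \<le> n"
  shows "order (A_graph r n a b) = n"
proof -
  have "card (verts (A_graph r n a b)) =
      card (Spine ` {1..n - (a + b) * r}) + card ((\<lambda>(i, j). Branch i j) ` ({1..a + b} \<times> {1..r}))"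
    unfolding verts_A_graph by (rule card_Un_disjoint) auto
  also have "card (Spine ` {1..n - (a + b) * r}) = n - (a + b) * r"
    by (subst card_image) (auto simp: inj_on_def)
  also have "card ((\<lambda>(i, j). Branch i j) ` ({1..a + b} \<times> {1..r})) = (a + b) * r"
    by (subst card_image) (auto simp: inj_on_def card_cartesian_product)
  finally show ?thesis
    using assms by (simp add: order_def)
qed

lemma simple_graph_A_graph:
  assumes "(a + b) * r + 2 \<le> n" and "1 \<le> r"
  shows "simple_graph (A_graph r n a b)"
proof -
  have "finite (verts (A_graph r n a b))"
    unfolding verts_A_graph by simp
  moreover have "\<forall>e\<in>edges (A_graph r n a b). e \<subseteq> verts (A_graph r n a b) \<and> card e = 2"
    using assms by (auto simp: A_graph_def Let_def card_insert_if)
  ultimately show ?thesis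
    by (simp add: simple_graph_def)
qed

end

theory Submission
  imports Defs
begin

text \<open>
  An edge of a tree with \<open>n\<close> vertices whose smaller side has \<open>s\<close> vertices contributes \<open>n - 2 * s\<close> to
  the Mostar index. The edges of \<open>k\<close> pendent paths of length \<open>r\<close> contribute the same amount in
  every tree, so it remains to maximise the sum of the numbers \<open>s\<close> over the other edges, the
  edges of the \<open>core\<close> of \<open>m = n - k * r\<close> vertices. For each \<open>t\<close>, the core edges with \<open>s \<ge> t\<close> form
  a subtree; two of its extremal edges cut off disjoint sides with at least \<open>t\<close> vertices each, one of
  which meets at most \<open>b = k div 2\<close> of the paths. Hence there are at most
  \<open>min (m - 1) (min (m + b * r - t) (n + 1 - 2 * t))\<close> such edges, and the balanced tree attains this
  bound for all \<open>t\<close> simultaneously. Equality at \<open>t = b * r + 1\<close> and \<open>t = b * r + 2\<close> forces the core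
  to be a path with the pendent paths attached in a balanced way to its two ends.
  Part (i) is the case of three leaves with \<open>r = 1\<close>, since a tree with a single pendent path of
  length \<open>r\<close> is not a path, and part (ii) is the case of two leaves with \<open>r = 1\<close>.
\<close>

section \<open>Walks and rooted trees\<close>

text \<open>A tree may spread its paths in any way over a branched core, and the sum of the numbers
  \<open>s\<close> alone does not reveal its shape. The layer counts do: domination at every
  \<open>t\<close> turns equality of the sums into equality at every \<open>t\<close>, in particular
  at the two decisive thresholds. These come from the balanced tree with \<open>a\<close> and
  \<open>b\<close> paths at its ends, \<open>b \<le> a \<le> b + 1\<close>: there no core edge has
  \<open>s\<close> below \<open>b * r + 1\<close>, and for \<open>a = b + 1\<close> at most one
  attains this value. Both properties pass to the given tree. Each end of its core then carries at
  least \<open>b\<close> paths, and three ends would need \<open>3 * b \<le> 2 * b + 1\<close> paths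
  together with two core edges attaining the least \<open>s\<close>; so the core is a path.

  The root is placed at an end of the core. The selected paths then ascend towards it, and the root
  side of the topmost core edge is one more end, on a par with the core leaves. The selected paths
  may be some among many pendent paths, which lets (i) and (ii) pass to length 1.\<close>

lemma edge_in_verts:
  "simple_graph G \<Longrightarrow> {x, y} \<in> edges G \<Longrightarrow> x \<in> verts G \<and> y \<in> verts G \<and> x \<noteq> y"
  by (fastforce simp: simple_graph_def)

lemma graph_walk_single: "graph_walk G [u] \<longleftrightarrow> u \<in> verts G"
  by (simp add: graph_walk_def)

lemma graph_walk_snoc:
  "us \<noteq> [] \<Longrightarrow> graph_walk G (us @ [x]) \<longleftrightarrow> graph_walk G us \<and> x \<in> verts G \<and> {last us, x} \<in> edges G"
  by (auto simp: graph_walk_def successively_append_iff)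

lemma graph_walk_append:
  "us \<noteq> [] \<Longrightarrow> vs \<noteq> [] \<Longrightarrow> graph_walk G (us @ vs) \<longleftrightarrow>
    graph_walk G us \<and> graph_walk G vs \<and> {last us, hd vs} \<in> edges G"
  by (auto simp: graph_walk_def successively_append_iff)

lemma graph_walk_nth_edge:
  "graph_walk G us \<Longrightarrow> Suc i < length us \<Longrightarrow> {us ! i, us ! Suc i} \<in> edges G"
  unfolding graph_walk_def by (metis successively_nth)

lemma graph_walk_imp_rtrancl:
  assumes "graph_walk G us"
  shows "(hd us, last us) \<in> {(x, y). {x, y} \<in> edges G}\<^sup>*"
  using assms
proof (induction us rule: rev_induct)
  case (snoc x us)
  show ?case
  proof (cases "us = []")
    case False
    with snoc have "(hd us, last us) \<in> {(x, y). {x, y} \<in> edges G}\<^sup>*" "{last us, x} \<in> edges G"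
      by (auto simp: graph_walk_snoc)
    then show ?thesis using False by (auto intro: rtrancl_into_rtrancl)
  qed simp
qed (simp add: graph_walk_def)

lemma rtrancl_imp_graph_walk:
  assumes "(u, v) \<in> {(x, y). {x, y} \<in> edges G}\<^sup>*" "u \<in> verts G" "simple_graph G"
  shows "\<exists>us. graph_walk G us \<and> hd us = u \<and> last us = v"
  using assms(1)
proof (induction rule: rtrancl_induct)
  case base
  then show ?case using assms(2) by (intro exI[of _ "[u]"]) (simp add: graph_walk_single)
next
  case (step y z)
  then obtain us where us: "graph_walk G us" "hd us = u" "last us = y" by blast
  moreover from us have "us \<noteq> []" by (auto simp: graph_walk_def)
  ultimately show ?case
    using step(2) edge_in_verts[OF assms(3)]
    by (intro exI[of _ "us @ [z]"]) (auto simp: graph_walk_snoc)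
qed

lemma graph_connected_iff_rtrancl:
  assumes "simple_graph G"
  shows "graph_connected G \<longleftrightarrow>
    (\<forall>u\<in>verts G. \<forall>v\<in>verts G. (u, v) \<in> {(x, y). {x, y} \<in> edges G}\<^sup>*)"
proof -
  have "(\<exists>us. graph_walk G us \<and> hd us = u \<and> last us = v) \<longleftrightarrow> (u, v) \<in> {(x, y). {x, y} \<in> edges G}\<^sup>*"
    if "u \<in> verts G" for u v
    using graph_walk_imp_rtrancl[of G] rtrancl_imp_graph_walk[OF _ that assms, of v] by auto
  then show ?thesis unfolding graph_connected_def by auto
qed

lemma successively_crossing:
  assumes "successively P us" "us \<noteq> []" "hd us \<in> X" "last us \<notin> X"
  shows "\<exists>as x y bs. us = as @ x # y # bs \<and> x \<in> X \<and> y \<notin> X \<and> P x y"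
  using assms
proof (induction us)
  case (Cons u us)
  then have ne: "us \<noteq> []" by auto
  show ?case
  proof (cases "hd us \<in> X")
    case True
    with Cons ne obtain as x y bs where "us = as @ x # y # bs \<and> x \<in> X \<and> y \<notin> X \<and> P x y"
      by (auto simp: successively_Cons)
    then show ?thesis by (intro exI[of _ "u # as"]) auto
  next
    case False
    with Cons ne show ?thesis
      by (intro exI[of _ "[]"] exI[of _ u] exI[of _ "hd us"] exI[of _ "tl us"])
        (auto simp: successively_Cons)
  qed
qed simp

section \<open>Distances and edge cuts\<close>

lemma graph_dist_le:
  "graph_walk G us \<Longrightarrow> graph_dist G (hd us) (last us) \<le> length us - 1"
  unfolding graph_dist_def
  by (rule Least_le) (auto simp: graph_walk_def intro!: exI[of _ us])

lemma graph_dist_walk: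
  assumes "graph_connected G" "u \<in> verts G" "v \<in> verts G"
  shows "\<exists>us. graph_walk G us \<and> hd us = u \<and> last us = v \<and> length us = Suc (graph_dist G u v)"
proof -
  obtain us where "graph_walk G us" "hd us = u" "last us = v"
    using assms unfolding graph_connected_def by blast
  moreover from this have "length us = Suc (length us - 1)" by (auto simp: graph_walk_def)
  ultimately show ?thesis
    unfolding graph_dist_def
    by (intro LeastI[where P = "\<lambda>l. \<exists>us. graph_walk G us \<and> hd us = u \<and> last us = v \<and> length us = Suc l"]) blast
qed

text \<open>A shortest walk from \<open>w\<close> to \<open>q\<close> has to leave \<open>X\<close>,
  and \<open>v\<close> is the only vertex of \<open>X\<close> from which that is possible; the part
  up to \<open>v\<close> is a strictly shorter walk.\<close>

lemma graph_dist_less_across_cut: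
  assumes "graph_connected G" "w \<in> verts G" "q \<in> verts G" "w \<in> X" "q \<notin> X"
    and cut: "\<And>x y. {x, y} \<in> edges G \<Longrightarrow> x \<in> X \<Longrightarrow> y \<notin> X \<Longrightarrow> x = v"
  shows "graph_dist G w v < graph_dist G w q"
proof -
  obtain us where us: "graph_walk G us" "hd us = w" "last us = q" "length us = Suc (graph_dist G w q)"
    using graph_dist_walk[OF assms(1-3)] by blast
  obtain as x y bs where s: "us = as @ x # y # bs" "x \<in> X" "y \<notin> X" "{x, y} \<in> edges G"
    using successively_crossing[of "\<lambda>x y. {x, y} \<in> edges G" us X] us assms
    unfolding graph_walk_def by metis
  have "x = v" using cut s by blast
  have "graph_walk G ((as @ [x]) @ y # bs)" using us s by simp
  then have "graph_walk G (as @ [x])" by (subst (asm) graph_walk_append) auto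
  from graph_dist_le[OF this] have "graph_dist G w v \<le> length as"
    using us s \<open>x = v\<close> by (cases as) auto
  then show ?thesis using us s by simp
qed

text \<open>An edge is named by its lower end, and one of its sides is then the set of descendants
  of that end. Setting \<open>p c = c\<close> makes all iterates of \<open>p\<close> total. The rank
  \<open>h\<close> can be any function decreasing along \<open>p\<close>, not just the depth: it
  serves for induction and for the choice of lowest and topmost vertices.\<close>

locale rooted_tree =
  fixes G :: "'a graph" and c :: 'a and p :: "'a \<Rightarrow> 'a" and h :: "'a \<Rightarrow> nat"
  assumes fin [simp]: "finite (verts G)"
    and root [simp]: "c \<in> verts G"
    and parent_root [simp]: "p c = c"
    and parent: "\<And>v. v \<in> verts G \<Longrightarrow> v \<noteq> c \<Longrightarrow> p v \<in> verts G \<and> h (p v) < h v"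
    and edges_eq: "edges G = {{v, p v} | v. v \<in> verts G \<and> v \<noteq> c}"
begin

definition D :: "'a \<Rightarrow> 'a set" where
  "D v = {w \<in> verts G. \<exists>i. (p ^^ i) w = v}"

definition children :: "'a \<Rightarrow> 'a set" where
  "children v = {w \<in> verts G. w \<noteq> c \<and> p w = v}"

lemma parent_in [simp]: "v \<in> verts G \<Longrightarrow> p v \<in> verts G"
  using parent by (cases "v = c") auto

lemma funpow_in [simp]: "v \<in> verts G \<Longrightarrow> (p ^^ i) v \<in> verts G"
  by (induction i) auto

lemma parent_neq: "v \<in> verts G \<Longrightarrow> v \<noteq> c \<Longrightarrow> p v \<noteq> v"
  using parent by fastforce

lemma funpow_root [simp]: "(p ^^ i) c = c"
  by (induction i) auto

lemma D_subset: "D v \<subseteq> verts G"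
  by (auto simp: D_def)

lemma D_finite [simp]: "finite (D v)"
  using D_subset fin finite_subset by blast

lemma D_self [simp]: "v \<in> verts G \<Longrightarrow> v \<in> D v"
  by (auto simp: D_def intro: exI[of _ 0])

lemma D_funpow: "w \<in> verts G \<Longrightarrow> w \<in> D ((p ^^ i) w)"
  by (auto simp: D_def)

lemma D_parent_iff:
  assumes "w \<in> verts G" "w \<noteq> v"
  shows "p w \<in> D v \<longleftrightarrow> w \<in> D v"
proof
  assume "p w \<in> D v"
  then obtain i where "(p ^^ i) (p w) = v" by (auto simp: D_def)
  then have "(p ^^ Suc i) w = v" by (simp add: funpow_swap1)
  then show "w \<in> D v" using assms unfolding D_def by blast
next
  assume "w \<in> D v"
  then obtain i where i: "(p ^^ i) w = v" by (auto simp: D_def)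
  with assms obtain j where "i = Suc j" by (cases i) auto
  with i have "(p ^^ j) (p w) = v" by (simp add: funpow_swap1)
  then show "p w \<in> D v" using assms by (auto simp: D_def)
qed

lemma D_trans: "u \<in> D v \<Longrightarrow> w \<in> D u \<Longrightarrow> w \<in> D v"
proof -
  assume "u \<in> D v" "w \<in> D u"
  then obtain i j where "(p ^^ i) ((p ^^ j) w) = v" "w \<in> verts G" by (auto simp: D_def)
  then show ?thesis unfolding D_def by (metis (mono_tags, lifting) comp_apply funpow_add mem_Collect_eq)
qed

lemma D_mono: "u \<in> D v \<Longrightarrow> D u \<subseteq> D v"
  using D_trans by blast

lemma D_comparable:
  assumes "w \<in> D u" "w \<in> D v"
  shows "u \<in> D v \<or> v \<in> D u"
proof -
  obtain i j where ij: "(p ^^ i) w = u" "(p ^^ j) w = v" and w: "w \<in> verts G"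
    using assms by (auto simp: D_def)
  have *: "(p ^^ (l - k)) ((p ^^ k) w) = (p ^^ l) w" if "k \<le> l" for k l
    using that by (metis comp_apply funpow_add le_add_diff_inverse2)
  have "(p ^^ (j - i)) u = v \<or> (p ^^ (i - j)) v = u"
    using *[of i j] *[of j i] ij by (cases "i \<le> j") auto
  then show ?thesis using ij w by (auto simp: D_def)
qed

lemma height_funpow: "w \<in> verts G \<Longrightarrow> h ((p ^^ i) w) \<le> h w"
proof (induction i)
  case (Suc i)
  then show ?case using parent[of "(p ^^ i) w"] by (cases "(p ^^ i) w = c") auto
qed simp

lemma D_height: "w \<in> D v \<Longrightarrow> w \<noteq> v \<Longrightarrow> h v < h w"
proof -
  assume a: "w \<in> D v" "w \<noteq> v"
  then obtain i where i: "(p ^^ i) w = v" and w: "w \<in> verts G" by (auto simp: D_def)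
  with a obtain j where "i = Suc j" by (cases i) auto
  with i have "(p ^^ j) (p w) = v" by (simp add: funpow_swap1)
  moreover have "w \<noteq> c" using a i by auto
  ultimately show "h v < h w" using parent[OF w] height_funpow[of "p w" j] by auto
qed

lemma root_in_D: "c \<in> D v \<longleftrightarrow> v = c"
  by (auto simp: D_def intro: exI[of _ 0])

lemma in_D_root: "w \<in> verts G \<Longrightarrow> w \<in> D c"
proof (induction "h w" arbitrary: w rule: less_induct)
  case less
  then show ?case using parent[of w] D_parent_iff[of w c] by (cases "w = c") auto
qed

lemma ex_root_distance:
  assumes "v \<in> verts G"
  shows "\<exists>N. (p ^^ N) v = c \<and> (\<forall>i<N. (p ^^ i) v \<noteq> c) \<and> (\<forall>i\<ge>N. (p ^^ i) v = c)"
proof -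
  define N where "N = (LEAST i. (p ^^ i) v = c)"
  obtain i where "(p ^^ i) v = c" using in_D_root[OF assms] by (auto simp: D_def)
  then have N: "(p ^^ N) v = c" unfolding N_def by (rule LeastI)
  moreover have "(p ^^ i) v \<noteq> c" if "i < N" for i using not_less_Least that unfolding N_def by blast
  moreover have "(p ^^ i) v = c" if "N \<le> i" for i
  proof -
    have "(p ^^ i) v = (p ^^ (i - N)) ((p ^^ N) v)"
      using that by (metis comp_apply funpow_add le_add_diff_inverse2)
    then show ?thesis using N by simp
  qed
  ultimately show ?thesis by blast
qed

text \<open>Membership in \<open>D v\<close> and in \<open>X\<close> passes between a vertex and its
  parent in both directions except at \<open>v\<close>, so the two sets agree by induction on
  \<open>h\<close>. This computes descendant sets without iterating \<open>p\<close>.\<close>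

lemma D_eqI:
  assumes v: "v \<in> verts G" "v \<noteq> c" "v \<in> X" and X: "X \<subseteq> verts G" "c \<notin> X"
    and step: "\<And>w. w \<in> verts G \<Longrightarrow> w \<noteq> c \<Longrightarrow> w \<noteq> v \<Longrightarrow> p w \<in> X \<longleftrightarrow> w \<in> X" and "p v \<notin> X"
  shows "D v = X"
proof -
  have "w \<in> D v \<longleftrightarrow> w \<in> X" if "w \<in> verts G" for w
    using that
  proof (induction "h w" arbitrary: w rule: less_induct)
    case less
    consider "w = c" | "w = v" | "w \<noteq> c" "w \<noteq> v" by blast
    then show ?case
    proof cases
      case 3
      then show ?thesis
        using less.hyps[of "p w"] parent[of w] D_parent_iff[of w v] step[of w] less.prems by blast
    qed (use v X root_in_D in auto)
  qed
  then show ?thesis using D_subset X by blast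
qed

lemma edge_iff:
  "{x, y} \<in> edges G \<longleftrightarrow>
    x \<in> verts G \<and> y \<in> verts G \<and> (x \<noteq> c \<and> y = p x \<or> y \<noteq> c \<and> x = p y)"
  unfolding edges_eq by (auto simp: doubleton_eq_iff)

lemma parent_edge: "v \<in> verts G \<Longrightarrow> v \<noteq> c \<Longrightarrow> {v, p v} \<in> edges G"
  by (auto simp: edges_eq)

lemma inj_on_parent_edge: "inj_on (\<lambda>v. {v, p v}) (verts G - {c})"
proof (rule inj_onI)
  fix v w
  assume "v \<in> verts G - {c}" "w \<in> verts G - {c}" and eq: "{v, p v} = {w, p w}"
  then have "h (p v) < h v" "h (p w) < h w" using parent by auto
  then show "v = w" using eq by (auto simp: doubleton_eq_iff)
qed

lemma edges_image: "edges G = (\<lambda>v. {v, p v}) ` (verts G - {c})"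
  unfolding edges_eq by auto

lemma simple: "simple_graph G"
  unfolding simple_graph_def edges_eq
  by (auto simp: card_2_iff dest: parent_neq)

lemma connected: "graph_connected G"
proof -
  let ?R = "{(x, y). {x, y} \<in> edges G}"
  have to_root: "(w, c) \<in> ?R\<^sup>*" if "w \<in> verts G" for w
    using that
  proof (induction "h w" arbitrary: w rule: less_induct)
    case less
    show ?case
    proof (cases "w = c")
      case False
      then have "(w, p w) \<in> ?R" "(p w, c) \<in> ?R\<^sup>*" using less parent parent_edge by auto
      then show ?thesis by (rule converse_rtrancl_into_rtrancl)
    qed simp
  qed
  have "sym ?R" unfolding sym_def by (simp add: insert_commute)
  then have "sym (?R\<^sup>*)" by (rule sym_rtrancl)
  then have from_root: "(c, w) \<in> ?R\<^sup>*" if "w \<in> verts G" for w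
    using to_root[OF that] by (rule symD)
  show ?thesis
    unfolding graph_connected_iff_rtrancl[OF simple]
    by (intro ballI rtrancl_trans[OF to_root from_root])
qed

lemma edge_top: "{x, y} \<in> edges G \<Longrightarrow> h y \<le> h x \<Longrightarrow> y = p x"
  unfolding edge_iff by (metis leD parent)

text \<open>On a cycle, both neighbours of a highest vertex would be its parent.\<close>

lemma acyclic: "\<not> graph_cycle G us"
proof
  assume cyc: "graph_cycle G us"
  define N where "N = length us"
  have walk: "graph_walk G us" and dist: "distinct us" and N: "N \<ge> 3"
    and "{last us, hd us} \<in> edges G"
    using cyc by (auto simp: graph_cycle_def graph_path_def N_def)
  moreover from N have "us \<noteq> []" by (auto simp: N_def)
  ultimately have close: "{us ! (N - 1), us ! 0} \<in> edges G"
    by (simp add: N_def hd_conv_nth last_conv_nth)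
  have e: "{us ! i, us ! Suc i} \<in> edges G" if "Suc i < N" for i
    using graph_walk_nth_edge[OF walk] that by (simp add: N_def)
  have e': "{us ! Suc i, us ! i} \<in> edges G" if "Suc i < N" for i
    using e[OF that] by (simp only: insert_commute)
  have close': "{us ! 0, us ! (N - 1)} \<in> edges G"
    using close by (simp only: insert_commute)
  define M where "M = Max (h ` set us)"
  have "M \<in> h ` set us" unfolding M_def using N by (intro Max_in) (auto simp: N_def)
  then obtain i where i: "i < N" "h (us ! i) = M" by (auto simp: in_set_conv_nth N_def)
  have top: "us ! j = p (us ! i)" if "{us ! i, us ! j} \<in> edges G" "j < N" for j
    using edge_top[OF that(1)] i that by (simp add: M_def N_def)
  have "\<exists>j k. j < N \<and> k < N \<and> j \<noteq> k \<and> {us ! i, us ! j} \<in> edges G \<and> {us ! i, us ! k} \<in> edges G"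
  proof -
    consider "i = 0" | "i = N - 1" "i \<noteq> 0" | "0 < i" "Suc i < N" using i by linarith
    then show ?thesis
    proof cases
      case 1
      then show ?thesis using N e[of 0] close'
        by (intro exI[of _ 1] exI[of _ "N - 1"]) auto
    next
      case 2
      then show ?thesis using N e'[of "N - 2"] close
        by (intro exI[of _ 0] exI[of _ "N - 2"]) (auto simp: numeral_2_eq_2 Suc_diff_Suc)
    next
      case 3
      then show ?thesis using N e[of i] e'[of "i - 1"]
        by (intro exI[of _ "i - 1"] exI[of _ "Suc i"]) auto
    qed
  qed
  then obtain j k where jk: "j < N" "k < N" "j \<noteq> k"
    "{us ! i, us ! j} \<in> edges G" "{us ! i, us ! k} \<in> edges G" by blast
  then have "us ! j = us ! k" using top[of j] top[of k] by simp
  then show False using nth_eq_iff_index_eq[OF dist, of j k] jk by (simp add: N_def)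
qed

lemma is_tree: "is_tree G"
  unfolding is_tree_def using simple connected acyclic root by (metis empty_iff)

text \<open>The edge between \<open>v\<close> and \<open>p v\<close> is the only one joining
  \<open>D v\<close> to its complement. Every walk across uses both of its ends, so each vertex is
  closer to the end on its own side.\<close>

lemma num_closer_parent:
  assumes v: "v \<in> verts G" "v \<noteq> c"
  shows "num_closer G v (p v) = card (D v)"
    and "num_closer G (p v) v = card (verts G) - card (D v)"
proof -
  have pv: "p v \<notin> D v" using D_height[of "p v" v] parent[OF v] by (metis less_asym less_irrefl)
  have cut: "x = v \<and> y = p v" if "{x, y} \<in> edges G" "x \<in> D v" "y \<notin> D v" for x y
    using that D_parent_iff[of x v] D_parent_iff[of y v] pv v root_in_D[of v]
    unfolding edge_iff by metis
  have "graph_dist G w v < graph_dist G w (p v)" if "w \<in> D v" for w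
    using that pv v cut D_subset by (intro graph_dist_less_across_cut[OF connected, where X = "D v"]) auto
  moreover have "graph_dist G w (p v) < graph_dist G w v" if "w \<in> verts G" "w \<notin> D v" for w
  proof (rule graph_dist_less_across_cut[OF connected, where X = "- D v"])
    fix x y
    assume "{x, y} \<in> edges G" "x \<in> - D v" "y \<notin> - D v"
    then show "x = p v" using cut[of y x] by (simp add: insert_commute)
  qed (use that v in auto)
  ultimately have "{w \<in> verts G. graph_dist G w v < graph_dist G w (p v)} = D v"
    "{w \<in> verts G. graph_dist G w (p v) < graph_dist G w v} = verts G - D v"
    using D_subset by (auto dest: less_asym)
  then show "num_closer G v (p v) = card (D v)"
    and "num_closer G (p v) v = card (verts G) - card (D v)"
    unfolding num_closer_def by (simp_all add: card_Diff_subset D_subset)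
qed

lemma card_D_le: "card (D v) \<le> card (verts G)"
  by (simp add: card_mono D_subset)

lemma mostar_index_eq:
  "mostar_index G = (\<Sum>v\<in>verts G - {c}. \<bar>int (card (verts G)) - 2 * int (card (D v))\<bar>)"
  unfolding mostar_index_def edges_image
proof (subst sum.reindex[OF inj_on_parent_edge], rule sum.cong[OF refl], goal_cases)
  case (1 v)
  then show ?case
    using card_D_le[of v] by (simp add: edge_contribution_eq num_closer_parent of_nat_diff)
qed

lemma children_finite [simp]: "finite (children v)"
  by (simp add: children_def)

lemma degree_eq:
  assumes "v \<in> verts G"
  shows "degree G v = card (children v) + (if v = c then 0 else 1)"
proof -
  have "{e \<in> edges G. v \<in> e} = (\<lambda>w. {w, p w}) ` (children v \<union> ({v} - {c}))"
    unfolding edges_image using assms by (auto simp: children_def)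
  moreover have "inj_on (\<lambda>w. {w, p w}) (children v \<union> ({v} - {c}))"
    by (rule inj_on_subset[OF inj_on_parent_edge]) (use assms in \<open>auto simp: children_def\<close>)
  ultimately have "degree G v = card (children v \<union> ({v} - {c}))"
    unfolding degree_def by (simp add: card_image)
  also have "\<dots> = card (children v) + card ({v} - {c})"
    using parent_neq by (intro card_Un_disjoint) (auto simp: children_def)
  finally show ?thesis by (auto simp: card_Diff_singleton)
qed

lemma funpow_height_strict:
  assumes "v \<in> verts G" "i < j" "\<And>l. l < j \<Longrightarrow> (p ^^ l) v \<noteq> c"
  shows "h ((p ^^ j) v) < h ((p ^^ i) v)"
  using assms(2,3)
proof (induction j)
  case (Suc j)
  have "h ((p ^^ Suc j) v) < h ((p ^^ j) v)"
    using parent[of "(p ^^ j) v"] Suc.prems(2)[of j] assms(1) by simp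
  then show ?case using Suc by (cases "i = j") (auto simp: less_Suc_eq)
qed simp

lemma funpow_inj:
  assumes "v \<in> verts G" "i \<le> j" "j \<le> r" "\<And>l. l < r \<Longrightarrow> (p ^^ l) v \<noteq> c" "(p ^^ i) v = (p ^^ j) v"
  shows "i = j"
  using funpow_height_strict[of v i j] assms by (cases "i = j") auto

text \<open>Produces the pendent paths of concrete trees by following parents from a leaf; the
  vertices are distinct because \<open>h\<close> decreases strictly before the root is
  reached.\<close>

lemma ascending_pendent_path:
  assumes "v \<in> verts G" "1 \<le> r" and nc: "\<And>i. i < r \<Longrightarrow> (p ^^ i) v \<noteq> c"
    and "degree G v = 1" "degree G ((p ^^ r) v) \<ge> 2"
    and "\<And>i. 1 \<le> i \<Longrightarrow> i < r \<Longrightarrow> degree G ((p ^^ i) v) = 2"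
  shows "map (\<lambda>i. (p ^^ i) v) [0..<Suc r] \<in> pendent_paths G r"
proof -
  let ?us = "map (\<lambda>i. (p ^^ i) v) [0..<Suc r]"
  have up: "{(p ^^ i) v, (p ^^ Suc i) v} \<in> edges G" if "i < r" for i
    using parent_edge[of "(p ^^ i) v"] nc[OF that] assms(1) by simp
  have nth: "?us ! i = (p ^^ i) v" if "i \<le> r" for i
    using that by (simp del: upt_Suc)
  have "\<forall>i. Suc i < length ?us \<longrightarrow> {?us ! i, ?us ! Suc i} \<in> edges G"
  proof (intro allI impI)
    fix i
    assume "Suc i < length ?us"
    then have "i < r" by simp
    then show "{?us ! i, ?us ! Suc i} \<in> edges G" using up[of i] nth[of i] nth[of "Suc i"] by simp
  qed
  moreover have "set ?us \<subseteq> verts G" using assms(1) unfolding set_map by (rule image_subsetI[OF funpow_in])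
  moreover have "?us \<noteq> []" by simp
  ultimately have "graph_walk G ?us"
    unfolding graph_walk_def successively_conv_nth by blast
  moreover have "distinct ?us"
    unfolding distinct_map
  proof (intro conjI inj_onI)
    fix i j
    assume "i \<in> set [0..<Suc r]" "j \<in> set [0..<Suc r]" and eq: "(p ^^ i) v = (p ^^ j) v"
    then have "i \<le> r" "j \<le> r" by auto
    then show "i = j"
      using funpow_inj[OF assms(1) _ _ nc eq] funpow_inj[OF assms(1) _ _ nc eq[symmetric]]
        nat_le_linear[of i j] by metis
  qed simp
  ultimately show ?thesis
    using assms nth[of 0] nth[of r] nth unfolding pendent_paths_def graph_path_def
    by (auto simp del: upt_Suc nth_map)
qed

end

section \<open>Pendent paths and rootings of trees\<close>

lemma degree_one_edge_unique:
  assumes "degree G v = 1" "{v, x} \<in> edges G" "{v, y} \<in> edges G"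
  shows "x = y"
proof -
  obtain e where e: "{e \<in> edges G. v \<in> e} = {e}"
    using assms(1) unfolding degree_def by (auto simp: card_1_singleton_iff)
  have "{v, x} \<in> {e \<in> edges G. v \<in> e}" "{v, y} \<in> {e \<in> edges G. v \<in> e}"
    using assms(2,3) by simp_all
  then have "{v, x} = {v, y}" unfolding e by simp
  then show ?thesis by (auto simp: doubleton_eq_iff)
qed

lemma degree_two_edge_unique:
  assumes "degree G v = 2" "{v, w} \<in> edges G" "{v, x} \<in> edges G" "{v, y} \<in> edges G" "x \<noteq> w" "y \<noteq> w"
  shows "x = y"
proof -
  obtain d e where e: "{e \<in> edges G. v \<in> e} = {d, e}"
    using assms(1) unfolding degree_def by (auto simp: card_2_iff)
  have "{v, z} \<in> {d, e}" if "{v, z} \<in> edges G" for z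
    unfolding e[symmetric] using that by simp
  then have "{v, w} \<in> {d, e}" "{v, x} \<in> {d, e}" "{v, y} \<in> {d, e}" using assms by blast+
  moreover have "{v, x} \<noteq> {v, w}" "{v, y} \<noteq> {v, w}" using assms by (auto simp: doubleton_eq_iff)
  ultimately have "{v, x} = {v, y}" by blast
  then show ?thesis by (auto simp: doubleton_eq_iff)
qed

lemma pendent_pathsD:
  assumes "us \<in> pendent_paths G r"
  shows "1 \<le> r" "graph_path G us" "length us = Suc r" "us \<noteq> []" "hd us = us ! 0"
    "degree G (us ! 0) = 1" "degree G (us ! r) \<ge> 2"
    "\<And>i. 1 \<le> i \<Longrightarrow> i < r \<Longrightarrow> degree G (us ! i) = 2"
    "\<And>i. i < r \<Longrightarrow> {us ! i, us ! Suc i} \<in> edges G"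
    "\<And>i j. i \<le> r \<Longrightarrow> j \<le> r \<Longrightarrow> us ! i = us ! j \<longleftrightarrow> i = j"
    "\<And>i. i \<le> r \<Longrightarrow> us ! i \<in> verts G"
proof -
  show 1: "1 \<le> r" "graph_path G us" and len: "length us = Suc r" and "us \<noteq> []"
    and "degree G (us ! 0) = 1" "degree G (us ! r) \<ge> 2"
    using assms by (auto simp: pendent_paths_def)
  then show "hd us = us ! 0" by (simp add: hd_conv_nth)
  show "\<And>i. 1 \<le> i \<Longrightarrow> i < r \<Longrightarrow> degree G (us ! i) = 2"
    using assms by (auto simp: pendent_paths_def)
  show "\<And>i. i < r \<Longrightarrow> {us ! i, us ! Suc i} \<in> edges G"
    using 1 len graph_walk_nth_edge[of G us] by (auto simp: graph_path_def)
  show "\<And>i j. i \<le> r \<Longrightarrow> j \<le> r \<Longrightarrow> us ! i = us ! j \<longleftrightarrow> i = j"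
    using 1 len nth_eq_iff_index_eq[of us] by (auto simp: graph_path_def)
  have "set us \<subseteq> verts G" using 1 by (simp add: graph_path_def graph_walk_def)
  moreover have "us ! i \<in> set us" if "i \<le> r" for i
    using that len by (intro nth_mem) simp
  ultimately show "\<And>i. i \<le> r \<Longrightarrow> us ! i \<in> verts G"
    by (rule subsetD)
qed

text \<open>The initial leaf determines a pendent path: degree 1 forces the second vertex, and
  degree 2 at an inner vertex forces the next vertex once the previous one is known. Counting
  pendent paths thus becomes counting their leaves.\<close>

lemma inj_on_hd_pendent_paths: "inj_on hd (pendent_paths G r)"
proof (rule inj_onI)
  fix us vs
  assume us: "us \<in> pendent_paths G r" and vs: "vs \<in> pendent_paths G r" and "hd us = hd vs"
  then have 0: "us ! 0 = vs ! 0" using pendent_pathsD(5) by metis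
  have eq: "us ! i = vs ! i" if "i \<le> r" for i
    using that
  proof (induction i rule: less_induct)
    case (less i)
    consider "i = 0" | "i = 1" | j where "i = Suc (Suc j)" by (metis One_nat_def not0_implies_Suc)
    then show ?case
    proof cases
      case 2
      then show ?thesis
        using degree_one_edge_unique[OF pendent_pathsD(6)[OF us], of "us ! 1" "vs ! 1"]
          pendent_pathsD(9)[OF us, of 0] pendent_pathsD(9)[OF vs, of 0] less.prems 0 by auto
    next
      case 3
      have j: "us ! j = vs ! j" "us ! Suc j = vs ! Suc j" using less.IH less.prems 3 by auto
      have "{us ! Suc j, us ! j} \<in> edges G" "{us ! Suc j, us ! i} \<in> edges G"
        "{us ! Suc j, vs ! i} \<in> edges G"
        using pendent_pathsD(9)[OF us, of j] pendent_pathsD(9)[OF us, of "Suc j"]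
          pendent_pathsD(9)[OF vs, of "Suc j"] less.prems 3 j by (auto simp: insert_commute)
      then show ?thesis
        using degree_two_edge_unique[of G "us ! Suc j" "us ! j" "us ! i" "vs ! i"]
          pendent_pathsD(8)[OF us, of "Suc j"] pendent_pathsD(10)[OF us, of i j]
          pendent_pathsD(10)[OF vs, of i j] less.prems 3 j by auto
    qed (use 0 in simp)
  qed
  show "us = vs"
    using pendent_pathsD(3)[OF us] pendent_pathsD(3)[OF vs] eq by (intro nth_equalityI) auto
qed

lemma pendent_path_first_edge:
  assumes "us \<in> pendent_paths G r"
  shows "take 2 us \<in> pendent_paths G 1"
proof -
  note us = pendent_pathsD[OF assms]
  have "take 2 us = [us ! 0, us ! 1]"
    using us(1,3) by (intro nth_equalityI) (auto simp: less_Suc_eq numeral_2_eq_2)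
  moreover have "degree G (us ! 1) \<ge> 2"
    using us(1,7) us(8)[of 1] by (cases "r = 1") auto
  ultimately show ?thesis
    using us(1,6) us(9)[of 0] us(10)[of 0 1] us(11)[of 0] us(11)[of 1]
    by (auto simp: pendent_paths_def graph_path_def graph_walk_def)
qed

text \<open>The first edge of a pendent path is itself a pendent path of length 1 with the same
  leaf. In part (ii) this turns two pendent paths of length \<open>r\<close> into two of length
  1.\<close>

lemma card_pendent_paths_le:
  assumes "finite (pendent_paths G 1)"
  shows "card (pendent_paths G r) \<le> card (pendent_paths G 1)"
proof (rule card_inj_on_le[of "take 2"])
  show "inj_on (take 2) (pendent_paths G r)"
  proof (rule inj_onI)
    fix us vs
    assume a: "us \<in> pendent_paths G r" "vs \<in> pendent_paths G r" and "take 2 us = take 2 vs"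
    then have "hd (take 2 us) = hd (take 2 vs)" by simp
    then have "hd us = hd vs" by (simp add: hd_take)
    then show "us = vs" using inj_onD[OF inj_on_hd_pendent_paths _ a] by simp
  qed
qed (use assms pendent_path_first_edge in auto)

lemma finite_pendent_paths:
  assumes "finite (verts G)"
  shows "finite (pendent_paths G r)"
  using finite_lists_length_eq[OF assms, of "Suc r"]
  by (rule finite_subset[rotated]) (auto simp: pendent_paths_def graph_path_def graph_walk_def)

context rooted_tree
begin

text \<open>As long as the root is avoided, the sole child of an inner path vertex is its
  predecessor on the path. Hence the next path vertex is its parent, and the number of descendants
  (the vertex included) grows by one per step.\<close>

lemma pendent_path_ascends:
  assumes "us \<in> pendent_paths G r" "c \<notin> set (take r us)"
  shows "i \<le> r \<Longrightarrow> us ! i = (p ^^ i) (us ! 0)"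
    and "i < r \<Longrightarrow> us ! i \<noteq> c \<and> card (D (us ! i)) = Suc i"
proof -
  note us = pendent_pathsD[OF assms(1)]
  have nc: "us ! i \<noteq> c" if "i < r" for i
    using assms(2) that us(3) by (auto simp: in_set_conv_nth)
  have "p (us ! i) = us ! Suc i \<and> card (D (us ! i)) = Suc i" if "i < r" for i
    using that
  proof (induction i)
    case 0
    have "p (us ! 0) = us ! 1"
      using degree_one_edge_unique[OF us(6) parent_edge] us(9)[of 0] us(11)[of 0] nc[of 0] 0 by auto
    moreover have "children (us ! 0) = {}"
      using degree_eq[OF us(11)[of 0]] us(6) nc[of 0] 0 by auto
    then have "D (us ! 0) = {us ! 0}"
      using us(11)[of 0] us(11)[of 1] nc[of 0] 0 calculation us(10)[of 0 1] us(1)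
      by (intro D_eqI) (auto simp: children_def)
    ultimately show ?case by simp
  next
    case (Suc i)
    let ?v = "us ! Suc i"
    have v: "?v \<in> verts G" "?v \<noteq> c" and d: "degree G ?v = 2" and u: "us ! i \<in> verts G" "us ! i \<noteq> c"
      and IH: "p (us ! i) = ?v" "card (D (us ! i)) = Suc i"
      using us(11)[of "Suc i"] us(11)[of i] us(8)[of "Suc i"] nc[of i] nc[of "Suc i"] Suc by auto
    \<comment> \<open>The predecessor is a child of \<open>?v\<close>, hence not its parent; with
      degree 2 only the next path vertex is left to be the parent.\<close>
    have "p ?v \<noteq> us ! i" using parent[OF v] parent[OF u] IH by auto
    then have pv: "p ?v = us ! Suc (Suc i)"
      using degree_two_edge_unique[OF d, of "us ! i"] parent_edge[OF v] us(9)[of i] us(9)[of "Suc i"]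
        us(10)[of i "Suc (Suc i)"] Suc.prems by (auto simp: insert_commute)
    have "card (children ?v) = 1" using degree_eq[OF v(1)] d v by auto
    moreover have "us ! i \<in> children ?v" using u IH by (simp add: children_def)
    ultimately have ch: "children ?v = {us ! i}" by (auto simp: card_1_singleton_iff)
    have ui: "us ! i \<in> D ?v" using u v IH D_funpow[of "us ! i" 1] by simp
    have vn: "?v \<notin> D (us ! i)" using D_height[of ?v "us ! i"] parent[OF u] IH by (metis less_asym)
    have pvn: "p ?v \<notin> D ?v" using D_height[of "p ?v" ?v] parent[OF v] by (metis less_asym less_irrefl)
    have "D ?v = insert ?v (D (us ! i))"
    proof (rule D_eqI[OF v])
      fix w
      assume w: "w \<in> verts G" "w \<noteq> c" "w \<noteq> ?v"
      show "p w \<in> insert ?v (D (us ! i)) \<longleftrightarrow> w \<in> insert ?v (D (us ! i))"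
      proof (cases "w = us ! i")
        case True
        then show ?thesis using IH u by simp
      next
        case False
        then have "p w \<noteq> ?v" using w ch by (auto simp: children_def)
        then show ?thesis using w D_parent_iff[OF w(1) False] by auto
      qed
    qed (use D_subset D_mono[OF ui] v u pvn root_in_D[of "us ! i"] parent_neq[OF v] in auto)
    then show ?case using IH pv vn by simp
  qed
  then have step: "p (us ! i) = us ! Suc i" "card (D (us ! i)) = Suc i" if "i < r" for i
    using that by auto
  show "us ! i = (p ^^ i) (us ! 0)" if "i \<le> r"
    using that
  proof (induction i)
    case (Suc i)
    then have "us ! Suc i = p (us ! i)" "us ! i = (p ^^ i) (us ! 0)" using step(1)[of i] by auto
    then show ?case by simp
  qed simp
  show "us ! i \<noteq> c \<and> card (D (us ! i)) = Suc i" if "i < r"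
    using that nc step by auto
qed

end

section \<open>Leaves, removal of leaves, and existence of rootings\<close>

lemma tree_leaf:
  assumes "is_tree G" "c \<in> verts G" "verts G \<noteq> {c}"
  shows "\<exists>v q. v \<in> verts G \<and> v \<noteq> c \<and> q \<in> verts G \<and> q \<noteq> v \<and> {v, q} \<in> edges G \<and>
    (\<forall>y. {v, y} \<in> edges G \<longrightarrow> y = q)"
proof -
  have simple: "simple_graph G" and fin: "finite (verts G)" and conn: "graph_connected G"
    and acyc: "\<And>us. \<not> graph_cycle G us"
    using assms by (auto simp: is_tree_def simple_graph_def)
  \<comment> \<open>The leaf will be the last vertex of a longest path that starts at
    \<open>c\<close>: another neighbour off the path would extend the path, and one on the path
    would close a cycle.\<close>
  let ?P = "\<lambda>us. graph_path G us \<and> hd us = c"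
  have bound: "length us < Suc (card (verts G))" if "?P us" for us
    using that card_mono[OF fin, of "set us"] distinct_card[of us]
    by (auto simp: graph_path_def graph_walk_def)
  have "?P [c]" using assms by (simp add: graph_path_def graph_walk_def)
  then obtain us where us: "?P us" and max: "\<And>vs. ?P vs \<Longrightarrow> length vs \<le> length us"
    using ex_has_greatest_nat[of ?P "[c]" length "Suc (card (verts G))"] bound by auto
  obtain x where x: "x \<in> verts G" "x \<noteq> c" using assms by auto
  then obtain vs where vs: "graph_walk G vs" "hd vs = c" "last vs = x"
    using conn assms unfolding graph_connected_def by blast
  then obtain y ys where "vs = c # y # ys"
    using x by (cases vs; cases "tl vs") (auto simp: graph_walk_def)
  then have "{c, y} \<in> edges G" using vs by (simp add: graph_walk_def)
  then have "?P [c, y]" using edge_in_verts[OF simple] by (auto simp: graph_path_def graph_walk_def)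
  from max[OF this] obtain as q v where s: "us = as @ [q, v]"
  proof -
    assume a: "\<And>as q v. us = as @ [q, v] \<Longrightarrow> thesis" and "length [c, y] \<le> length us"
    then have "us \<noteq> []" "butlast us \<noteq> []" by (auto simp flip: length_greater_0_conv)
    then have "us = butlast (butlast us) @ [last (butlast us), last us]"
      by (metis append.assoc append_Cons append_Nil append_butlast_last_id)
    then show thesis by (rule a)
  qed
  have walk: "graph_walk G us" and dist: "distinct us" using us by (auto simp: graph_path_def)
  have qv: "{q, v} \<in> edges G" "v \<in> verts G" "q \<in> verts G"
    using walk s by (auto simp: graph_walk_def successively_append_iff)
  have "us \<noteq> []" using s by simp
  have "v \<noteq> c" using us s dist by (cases as) auto
  moreover have "y = q" if e: "{v, y} \<in> edges G" for y
  proof (rule ccontr)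
    assume "y \<noteq> q"
    have y: "y \<in> verts G" "y \<noteq> v" using edge_in_verts[OF simple e] by auto
    show False
    proof (cases "y \<in> set us")
      case False
      have "graph_walk G (us @ [y])" using walk e y s by (subst graph_walk_snoc) auto
      then have "?P (us @ [y])" using us dist False \<open>us \<noteq> []\<close> by (simp add: graph_path_def)
      then have "length (us @ [y]) \<le> length us" by (rule max)
      then show False by simp
    next
      case True
      then have "y \<in> set as" using s y \<open>y \<noteq> q\<close> by auto
      then obtain bs cs where as: "as = bs @ y # cs" by (auto simp: in_set_conv_decomp)
      have "graph_walk G (y # cs @ [q, v])"
        using walk s as by (auto simp: graph_walk_def successively_append_iff)
      then have "graph_cycle G (y # cs @ [q, v])"
        using dist s as e by (auto simp: graph_cycle_def graph_path_def)
      then show False using acyc by blast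
    qed
  qed
  moreover have "q \<noteq> v" using s dist by auto
  ultimately show ?thesis using qv by (metis insert_commute)
qed

lemma is_tree_remove_leaf:
  assumes "is_tree G" "v \<in> verts G" "q \<in> verts G" "q \<noteq> v" and qv: "{v, q} \<in> edges G"
    and leaf: "\<And>y. {v, y} \<in> edges G \<Longrightarrow> y = q"
  shows "is_tree \<lparr>verts = verts G - {v}, edges = edges G - {{v, q}}\<rparr>" (is "is_tree ?H")
proof -
  have simple: "simple_graph G" and conn: "graph_connected G"
    and acyc: "\<And>us. \<not> graph_cycle G us"
    using assms(1) by (auto simp: is_tree_def)
  have e: "e \<subseteq> verts G - {v} \<and> card e = 2" if "e \<in> edges G - {{v, q}}" for e
  proof -
    have "e \<subseteq> verts G" "card e = 2" using that simple by (auto simp: simple_graph_def)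
    moreover have "v \<notin> e"
    proof
      assume "v \<in> e"
      then obtain y where "e = {v, y}" using \<open>card e = 2\<close> by (auto simp: card_2_iff)
      then show False using leaf that by auto
    qed
    ultimately show ?thesis by auto
  qed
  then have simpleH: "simple_graph ?H" using simple by (auto simp: simple_graph_def)
  let ?R = "{(x, y). {x, y} \<in> edges G}" and ?S = "{(x, y). {x, y} \<in> edges ?H}"
  \<comment> \<open>Reachability survives the deletion: while a walk in \<open>G\<close> is at
    \<open>v\<close>, the induction keeps it waiting at \<open>q\<close>, the only vertex from which
    \<open>v\<close> can be entered or left.\<close>
  have "(x \<noteq> v \<longrightarrow> (u, x) \<in> ?S\<^sup>*) \<and> (x = v \<longrightarrow> (u, q) \<in> ?S\<^sup>*)" if "(u, x) \<in> ?R\<^sup>*" "u \<noteq> v" for u x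
    using that(1)
  proof (induction rule: rtrancl_induct)
    case base
    then show ?case using that by simp
  next
    case (step x y)
    show ?case
    proof (cases "x = v \<or> y = v")
      case True
      then have "x = v \<and> y = q \<or> y = v \<and> x = q"
        using step(2) leaf[of y] leaf[of x] by (auto simp: insert_commute)
      then show ?thesis using step assms(4) by auto
    next
      case False
      then have "(x, y) \<in> ?S" using step(2) by (auto simp: doubleton_eq_iff)
      then show ?thesis using step False by (auto intro: rtrancl_into_rtrancl)
    qed
  qed
  then have "graph_connected ?H"
    using conn unfolding graph_connected_iff_rtrancl[OF simple] graph_connected_iff_rtrancl[OF simpleH]
    by auto
  moreover have "\<not> graph_cycle ?H us" for us
  proof
    assume a: "graph_cycle ?H us"
    then have "graph_walk G us"
      by (auto simp: graph_cycle_def graph_path_def graph_walk_def elim: successively_mono)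
    then have "graph_cycle G us" using a by (auto simp: graph_cycle_def graph_path_def)
    then show False using acyc by blast
  qed
  ultimately show ?thesis using simpleH assms(3,4) by (auto simp: is_tree_def)
qed

text \<open>Induction on the number of vertices: a leaf other than \<open>c\<close> is removed, the
  rest is rooted at \<open>c\<close>, and the leaf is put back as a child of its neighbour with the
  next higher rank.\<close>

lemma rooted_tree_exists:
  assumes "is_tree G" "c \<in> verts G"
  shows "\<exists>p h. rooted_tree G c p h"
  using assms
proof (induction "card (verts G)" arbitrary: G rule: less_induct)
  case less
  have simple: "simple_graph G" and fin: "finite (verts G)"
    using less.prems by (auto simp: is_tree_def simple_graph_def)
  show ?case
  proof (cases "verts G = {c}")
    case True
    have "e \<notin> edges G" for e
      using simple True card_mono[of "{c}" e] by (auto simp: simple_graph_def)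
    then have "rooted_tree G c (\<lambda>_. c) (\<lambda>_. 0)"
      using True by unfold_locales auto
    then show ?thesis by blast
  next
    case False
    then obtain v q where v: "v \<in> verts G" "v \<noteq> c" "q \<in> verts G" "q \<noteq> v" "{v, q} \<in> edges G"
      and leaf: "\<And>y. {v, y} \<in> edges G \<Longrightarrow> y = q"
      using tree_leaf[OF less.prems] by blast
    let ?H = "\<lparr>verts = verts G - {v}, edges = edges G - {{v, q}}\<rparr>"
    have "is_tree ?H" using is_tree_remove_leaf[OF less.prems(1)] v leaf by blast
    moreover have "card (verts ?H) < card (verts G)" using card_Diff1_less[OF fin v(1)] by (simp only: graph.select_convs)
    ultimately obtain p h where H: "rooted_tree ?H c p h"
      using less.hyps[of ?H] less.prems(2) v(2) by auto
    interpret H: rooted_tree ?H c p h by (rule H)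
    have Hp: "p x \<in> verts G \<and> p x \<noteq> v \<and> h (p x) < h x" if "x \<in> verts G" "x \<noteq> c" "x \<noteq> v" for x
      using H.parent[of x] that by auto
    have "edges G = insert {v, q} (edges ?H)" using v by auto
    also have "\<dots> = {{x, (p(v := q)) x} | x. x \<in> verts G \<and> x \<noteq> c}"
      unfolding H.edges_eq using v by (auto split: if_splits)
    finally have "rooted_tree G c (p(v := q)) (h(v := Suc (h q)))"
      using fin less.prems v Hp by unfold_locales auto
    then show ?thesis by blast
  qed
qed

text \<open>Under any rooting, a vertex of \<open>X\<close> with maximal rank can have no neighbour
  in \<open>X\<close> but its parent. Applied to the vertices outside the selected paths, this
  supplies a root at an end of the core.\<close>

lemma tree_end_in_subset:
  assumes "is_tree G" "X \<subseteq> verts G" "X \<noteq> {}"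
  shows "\<exists>v\<in>X. \<forall>x\<in>X. \<forall>y\<in>X. {v, x} \<in> edges G \<longrightarrow> {v, y} \<in> edges G \<longrightarrow> x = y"
proof -
  obtain c where "c \<in> verts G" using assms by auto
  then obtain p h where "rooted_tree G c p h" using rooted_tree_exists[OF assms(1)] by blast
  then interpret rooted_tree G c p h .
  have fX: "finite X" using assms fin finite_subset by blast
  have "Max (h ` X) \<in> h ` X" using fX assms by auto
  then obtain v where v: "v \<in> X" "h v = Max (h ` X)" by auto
  then have "h x \<le> h v" if "x \<in> X" for x using fX that by auto
  then have "x = p v" if "x \<in> X" "{v, x} \<in> edges G" for x
    using edge_top[of v x] that by blast
  then show ?thesis using v(1) by metis
qed

section \<open>Graph embeddings\<close>

definition map_graph :: "('a \<Rightarrow> 'b) \<Rightarrow> 'a graph \<Rightarrow> 'b graph" where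
  "map_graph f G = \<lparr>verts = f ` verts G, edges = (`) f ` edges G\<rparr>"

text \<open>Minimality is assumed among graphs on one vertex type, whereas the extremal trees live
  on \<open>bvertex\<close>; every notion in the definition of the class is therefore carried along
  a map that is injective on the vertices.\<close>

locale graph_embedding =
  fixes G :: "'a graph" and f :: "'a \<Rightarrow> 'b"
  assumes simple: "simple_graph G" and inj: "inj_on f (verts G)"
begin

abbreviation "H \<equiv> map_graph f G"

lemma verts_map: "verts H = f ` verts G"
  by (simp add: map_graph_def)

lemma edge_subset: "e \<in> edges G \<Longrightarrow> e \<subseteq> verts G"
  using simple by (auto simp: simple_graph_def)

lemma inj_on_edges: "inj_on ((`) f) (edges G)"
  by (rule inj_onI) (use inj_on_image_eq_iff[OF inj] edge_subset in blast)

lemma image_edge_iff: "e \<subseteq> verts G \<Longrightarrow> f ` e \<in> edges H \<longleftrightarrow> e \<in> edges G"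
  using inj_on_image_eq_iff[OF inj] edge_subset by (fastforce simp: map_graph_def)

lemma edge_map_iff: "x \<in> verts G \<Longrightarrow> y \<in> verts G \<Longrightarrow> {f x, f y} \<in> edges H \<longleftrightarrow> {x, y} \<in> edges G"
  using image_edge_iff[of "{x, y}"] by simp

lemma simple_map: "simple_graph H"
  unfolding simple_graph_def
proof (intro conjI ballI)
  show "finite (verts H)" using simple by (simp add: verts_map simple_graph_def)
next
  fix e'
  assume "e' \<in> edges H"
  then obtain e where e: "e \<in> edges G" "e' = f ` e" by (auto simp: map_graph_def)
  then have "card e = 2" "e \<subseteq> verts G" using simple by (auto simp: simple_graph_def)
  then show "e' \<subseteq> verts H" "card e' = 2"
    using e inj card_image[of f e] inj_on_subset[OF inj] by (auto simp: verts_map)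
qed

lemma walk_map:
  assumes "set us \<subseteq> verts G"
  shows "graph_walk H (map f us) \<longleftrightarrow> graph_walk G us"
proof -
  have "successively (\<lambda>x y. {f x, f y} \<in> edges H) us \<longleftrightarrow> successively (\<lambda>x y. {x, y} \<in> edges G) us"
    using assms edge_map_iff by (intro successively_cong) auto
  then show ?thesis using assms by (auto simp: graph_walk_def verts_map successively_map)
qed

lemma path_map: "set us \<subseteq> verts G \<Longrightarrow> graph_path H (map f us) \<longleftrightarrow> graph_path G us"
  using walk_map inj_on_subset[OF inj] by (auto simp: graph_path_def distinct_map)

lemma walk_lift:
  assumes "graph_walk H vs"
  obtains us where "vs = map f us" "set us \<subseteq> verts G" "graph_walk G us"
proof -
  have "vs \<in> lists (f ` verts G)" using assms by (auto simp: graph_walk_def verts_map)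
  then obtain us where "vs = map f us" "set us \<subseteq> verts G" by (auto simp: lists_image)
  then show thesis using that walk_map assms by blast
qed

lemma f_eq_iff: "x \<in> verts G \<Longrightarrow> y \<in> verts G \<Longrightarrow> f x = f y \<longleftrightarrow> x = y"
  using inj by (auto dest: inj_onD)

lemma walk_in: "graph_walk G us \<Longrightarrow> set us \<subseteq> verts G \<and> us \<noteq> [] \<and> hd us \<in> verts G \<and> last us \<in> verts G"
  by (auto simp: graph_walk_def)

lemma walk_length_map:
  assumes "u \<in> verts G" "v \<in> verts G"
  shows "(\<exists>us. graph_walk H us \<and> hd us = f u \<and> last us = f v \<and> length us = l) \<longleftrightarrow>
    (\<exists>us. graph_walk G us \<and> hd us = u \<and> last us = v \<and> length us = l)" (is "?L \<longleftrightarrow> ?R")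
proof
  assume ?L
  then obtain us where us: "graph_walk H us" "hd us = f u" "last us = f v" "length us = l" by blast
  obtain vs where vs: "us = map f vs" "set vs \<subseteq> verts G" "graph_walk G vs"
    using walk_lift[OF us(1)] .
  then have "hd vs = u" "last vs = v"
    using us walk_in[OF vs(3)] assms f_eq_iff by (auto simp: hd_map last_map)
  then show ?R using us vs by auto
next
  assume ?R
  then obtain us where us: "graph_walk G us" "hd us = u" "last us = v" "length us = l" by blast
  then show ?L
    using walk_in[OF us(1)] walk_map by (intro exI[of _ "map f us"]) (auto simp: hd_map last_map)
qed

lemma dist_map: "u \<in> verts G \<Longrightarrow> v \<in> verts G \<Longrightarrow> graph_dist H (f u) (f v) = graph_dist G u v"
  unfolding graph_dist_def by (simp add: walk_length_map)

lemma num_closer_map: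
  assumes "u \<in> verts G" "v \<in> verts G"
  shows "num_closer H (f u) (f v) = num_closer G u v"
proof -
  have "{w \<in> verts H. graph_dist H w (f u) < graph_dist H w (f v)} =
    f ` {w \<in> verts G. graph_dist G w u < graph_dist G w v}"
    using assms by (auto simp: verts_map dist_map)
  then show ?thesis
    unfolding num_closer_def by (simp add: card_image inj_on_subset[OF inj])
qed

lemma mostar_map: "mostar_index H = mostar_index G"
proof -
  have "edge_contribution H (f ` e) = edge_contribution G e" if "e \<in> edges G" for e
  proof -
    have "card e = 2" using that simple by (auto simp: simple_graph_def)
    then obtain u v where "e = {u, v}" by (auto simp: card_2_iff)
    then show ?thesis
      using edge_subset[OF that] by (simp add: edge_contribution_eq num_closer_map)
  qed
  then show ?thesis
    unfolding mostar_index_def by (simp add: map_graph_def sum.reindex[OF inj_on_edges])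
qed

lemma order_map: "order H = order G"
  by (simp add: order_def verts_map card_image[OF inj])

lemma degree_map:
  assumes "v \<in> verts G"
  shows "degree H (f v) = degree G v"
proof -
  have "{e \<in> edges H. f v \<in> e} = (`) f ` {e \<in> edges G. v \<in> e}"
    using inj_on_image_mem_iff[OF inj assms] edge_subset by (simp add: map_graph_def image_Collect) blast
  then show ?thesis
    unfolding degree_def by (simp add: card_image inj_on_subset[OF inj_on_edges])
qed

lemma pendent_map_iff:
  assumes "set us \<subseteq> verts G"
  shows "map f us \<in> pendent_paths H r \<longleftrightarrow> us \<in> pendent_paths G r"
proof (cases "length us = Suc r")
  case True
  have deg: "degree H (map f us ! i) = degree G (us ! i)" if "i \<le> r" for i
    using that assms True by (simp add: degree_map subset_code(1))
  then have "degree H (map f us ! i) = degree G (us ! i)" if "i \<in> {1..r - 1}" for i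
    using that by (intro deg) auto
  then have "(\<forall>i\<in>{1..r - 1}. degree H (map f us ! i) = 2) \<longleftrightarrow> (\<forall>i\<in>{1..r - 1}. degree G (us ! i) = 2)"
    and "degree H (map f us ! 0) = degree G (us ! 0)" "degree H (map f us ! r) = degree G (us ! r)"
    using deg by simp_all
  then show ?thesis using path_map[OF assms] by (simp only: pendent_paths_def mem_Collect_eq length_map)
qed (simp add: pendent_paths_def)

lemma pendent_map: "pendent_paths H r = map f ` pendent_paths G r"
proof
  show "pendent_paths H r \<subseteq> map f ` pendent_paths G r"
  proof
    fix vs
    assume vs: "vs \<in> pendent_paths H r"
    then have "graph_walk H vs" by (simp add: pendent_paths_def graph_path_def)
    then obtain us where "vs = map f us" "set us \<subseteq> verts G" using walk_lift by blast
    then show "vs \<in> map f ` pendent_paths G r" using vs pendent_map_iff by auto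
  qed
next
  have "set us \<subseteq> verts G" if "us \<in> pendent_paths G r" for us
    using that by (simp add: pendent_paths_def graph_path_def graph_walk_def)
  then show "map f ` pendent_paths G r \<subseteq> pendent_paths H r"
    using pendent_map_iff by blast
qed

lemma card_pendent_map: "card (pendent_paths H r) = card (pendent_paths G r)"
proof -
  have "inj_on (map f) (lists (verts G))"
  proof (rule inj_onI)
    fix us vs
    assume "us \<in> lists (verts G)" "vs \<in> lists (verts G)" and eq: "map f us = map f vs"
    then have "inj_on f (set us \<union> set vs)" by (intro inj_on_subset[OF inj]) auto
    then show "us = vs" using eq map_inj_on by blast
  qed
  then have "inj_on (map f) (pendent_paths G r)"
    by (rule inj_on_subset) (auto simp: pendent_paths_def graph_path_def graph_walk_def)
  then show ?thesis unfolding pendent_map by (rule card_image)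
qed

lemma is_tree_map:
  assumes "is_tree G"
  shows "is_tree H"
proof -
  have "graph_connected H"
    unfolding graph_connected_def verts_map
  proof (clarify)
    fix u v
    assume uv: "u \<in> verts G" "v \<in> verts G"
    then obtain us where "graph_walk G us" "hd us = u" "last us = v"
      using assms unfolding is_tree_def graph_connected_def by blast
    then show "\<exists>us. graph_walk H us \<and> hd us = f u \<and> last us = f v"
      using walk_length_map[OF uv, of "length us"] by blast
  qed
  moreover have "\<not> graph_cycle H vs" for vs
  proof
    assume vs: "graph_cycle H vs"
    then have "graph_walk H vs" by (simp add: graph_cycle_def graph_path_def)
    then obtain us where us: "vs = map f us" "set us \<subseteq> verts G" "graph_walk G us"
      by (rule walk_lift)
    then have "graph_cycle G us"
      using vs path_map edge_map_iff[of "last us" "hd us"] walk_in[OF us(3)]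
      by (auto simp: graph_cycle_def hd_map last_map)
    then show False using assms by (auto simp: is_tree_def)
  qed
  ultimately show ?thesis using assms simple_map by (auto simp: is_tree_def verts_map)
qed

lemma iso_map: "G \<cong>\<^sub>g H"
  unfolding graph_iso_def using edge_map_iff inj by (auto simp: verts_map bij_betw_def)

end

section \<open>Isomorphisms between simple graphs\<close>

lemma graph_iso_eq_map:
  assumes "G \<cong>\<^sub>g H" "simple_graph G" "simple_graph H"
  shows "\<exists>f. inj_on f (verts G) \<and> H = map_graph f G"
proof -
  obtain f where f: "bij_betw f (verts G) (verts H)"
    and e: "\<And>u v. u \<in> verts G \<Longrightarrow> v \<in> verts G \<Longrightarrow> {u, v} \<in> edges G \<longleftrightarrow> {f u, f v} \<in> edges H"
    using assms(1) unfolding graph_iso_def by blast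
  have "edges H = (`) f ` edges G"
  proof (intro equalityI subsetI)
    fix d
    assume d: "d \<in> edges H"
    then obtain x y where xy: "d = {x, y}" "x \<in> verts H" "y \<in> verts H"
      using assms(3) unfolding simple_graph_def by (metis card_2_iff insert_subset)
    then obtain u v where "u \<in> verts G" "v \<in> verts G" "x = f u" "y = f v"
      using f unfolding bij_betw_def by blast
    then show "d \<in> (`) f ` edges G" using d xy e by (intro image_eqI[of _ _ "{u, v}"]) auto
  next
    fix d
    assume "d \<in> (`) f ` edges G"
    then obtain u v where "d = {f u, f v}" "{u, v} \<in> edges G" "u \<in> verts G" "v \<in> verts G"
      using assms(2) unfolding simple_graph_def
      by (smt (verit) card_2_iff imageE image_empty image_insert insert_subset)
    then show "d \<in> edges H" using e by auto
  qed
  moreover have "verts H = f ` verts G" and inj: "inj_on f (verts G)"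
    using f by (simp_all add: bij_betw_def)
  ultimately have "H = map_graph f G" unfolding map_graph_def by (intro graph.equality) simp_all
  then show ?thesis using inj by blast
qed

lemma mostar_index_iso:
  assumes "G \<cong>\<^sub>g H" "simple_graph G" "simple_graph H"
  shows "mostar_index G = mostar_index H"
proof -
  obtain f where f: "inj_on f (verts G)" "H = map_graph f G" using graph_iso_eq_map[OF assms] by blast
  interpret graph_embedding G f using f assms by unfold_locales auto
  show ?thesis using mostar_map f by simp
qed

lemma graph_iso_sym:
  assumes "G \<cong>\<^sub>g H"
  shows "H \<cong>\<^sub>g G"
proof -
  obtain f where f: "bij_betw f (verts G) (verts H)"
    and e: "\<forall>u\<in>verts G. \<forall>v\<in>verts G. {u, v} \<in> edges G \<longleftrightarrow> {f u, f v} \<in> edges H"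
    using assms unfolding graph_iso_def by blast
  let ?g = "inv_into (verts G) f"
  have g: "bij_betw ?g (verts H) (verts G)" using f by (rule bij_betw_inv_into)
  have "{u, v} \<in> edges H \<longleftrightarrow> {?g u, ?g v} \<in> edges G" if "u \<in> verts H" "v \<in> verts H" for u v
    using e bij_betw_apply[OF g] bij_betw_inv_into_right[OF f] that by simp
  then show ?thesis unfolding graph_iso_def using g by blast
qed

lemma graph_iso_trans:
  assumes "G \<cong>\<^sub>g H" "H \<cong>\<^sub>g K"
  shows "G \<cong>\<^sub>g K"
proof -
  obtain f g where f: "bij_betw f (verts G) (verts H)"
    and e: "\<forall>u\<in>verts G. \<forall>v\<in>verts G. {u, v} \<in> edges G \<longleftrightarrow> {f u, f v} \<in> edges H"
    and g: "bij_betw g (verts H) (verts K)"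
    and d: "\<forall>u\<in>verts H. \<forall>v\<in>verts H. {u, v} \<in> edges H \<longleftrightarrow> {g u, g v} \<in> edges K"
    using assms unfolding graph_iso_def by blast
  have "bij_betw (g \<circ> f) (verts G) (verts K)" using f g by (rule bij_betw_trans)
  moreover have "{u, v} \<in> edges G \<longleftrightarrow> {(g \<circ> f) u, (g \<circ> f) v} \<in> edges K"
    if "u \<in> verts G" "v \<in> verts G" for u v
    using that e d bij_betw_apply[OF f] by simp
  ultimately show ?thesis unfolding graph_iso_def by blast
qed

lemma graph_isoI:
  assumes simple: "simple_graph G" and "inj_on f (verts G)"
    and "f ` verts G = verts H" and "(`) f ` edges G = edges H"
  shows "G \<cong>\<^sub>g H"
proof -
  interpret graph_embedding G f using assms by unfold_locales
  have "map_graph f G = H"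
    using assms(3,4) by (intro graph.equality) (simp_all add: map_graph_def)
  then show ?thesis using iso_map by simp
qed

section \<open>Rooted trees with distinguished pendent paths\<close>

lemma sum_layers:
  fixes f :: "'a \<Rightarrow> nat"
  assumes "finite X" "\<And>x. x \<in> X \<Longrightarrow> f x \<le> N"
  shows "sum f X = (\<Sum>t=1..N. card {x \<in> X. t \<le> f x})"
proof -
  have "f x = (\<Sum>t=1..N. if t \<le> f x then 1 else 0)" if "x \<in> X" for x
  proof -
    have "{1..N} \<inter> {t. t \<le> f x} = {1..f x}" using assms(2)[OF that] by auto
    then show ?thesis by (simp add: sum.If_cases)
  qed
  then have "sum f X = (\<Sum>x\<in>X. \<Sum>t=1..N. if t \<le> f x then 1 else 0)" by (rule sum.cong[OF refl])
  also have "\<dots> = (\<Sum>t=1..N. \<Sum>x\<in>X. if t \<le> f x then 1 else 0)" by (rule sum.swap)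
  also have "\<dots> = (\<Sum>t=1..N. card {x \<in> X. t \<le> f x})"
    using assms(1) by (simp add: sum.If_cases Int_def)
  finally show ?thesis .
qed

text \<open>The sums of the layer counts are the sums of \<open>f\<close> and \<open>g\<close>, so
  domination in each layer and the reverse inequality between the sums leave no slack anywhere. Here
  \<open>f\<close> will give the smaller sides in the given tree and \<open>g\<close> those in the
  balanced tree.\<close>

lemma layers_eq_if_sum_ge:
  fixes f :: "'a \<Rightarrow> nat" and g :: "'b \<Rightarrow> nat"
  assumes "finite X" "finite Y"
    and le: "\<And>t. 1 \<le> t \<Longrightarrow> card {x \<in> X. t \<le> f x} \<le> card {y \<in> Y. t \<le> g y}"
    and ge: "sum g Y \<le> sum f X" and "1 \<le> t"
  shows "card {x \<in> X. t \<le> f x} = card {y \<in> Y. t \<le> g y}"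
proof -
  \<comment> \<open>Including \<open>t\<close> in the maximum ensures that the layer of interest is
    among the summed ones.\<close>
  define N where "N = Max (insert t (f ` X \<union> g ` Y))"
  have fN: "f x \<le> N" if "x \<in> X" for x using assms(1,2) that by (auto simp: N_def)
  have gN: "g y \<le> N" if "y \<in> Y" for y using assms(1,2) that by (auto simp: N_def)
  have tN: "t \<le> N" using assms(1,2) by (auto simp: N_def)
  have "(\<Sum>s=1..N. card {x \<in> X. s \<le> f x}) = (\<Sum>s=1..N. card {y \<in> Y. s \<le> g y})"
  proof (rule antisym)
    show "(\<Sum>s=1..N. card {y \<in> Y. s \<le> g y}) \<le> (\<Sum>s=1..N. card {x \<in> X. s \<le> f x})"
      using ge sum_layers[OF assms(1) fN] sum_layers[OF assms(2) gN] by simp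
  qed (use le in \<open>auto intro: sum_mono\<close>)
  then show ?thesis
    using sum_mono_inv[of "\<lambda>s. card {x \<in> X. s \<le> f x}" "{1..N}" "\<lambda>s. card {y \<in> Y. s \<le> g y}" t]
      le \<open>1 \<le> t\<close> tN by auto
qed

lemma card_Diff_Diff:
  assumes "finite A" "B \<subseteq> A" "C \<subseteq> A" "B \<inter> C = {}"
  shows "card (A - B - C) + card B + card C = card A"
proof -
  have "card (B \<union> C) = card B + card C"
    using assms finite_subset by (intro card_Un_disjoint) auto
  moreover have "card (A - (B \<union> C)) = card A - card (B \<union> C)" "card (B \<union> C) \<le> card A"
    using assms finite_subset[of "B \<union> C" A] by (auto intro: card_Diff_subset card_mono)
  moreover have "A - B - C = A - (B \<union> C)" by blast
  ultimately show ?thesis by simp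
qed

text \<open>\<open>L\<close> consists of the leaves of the selected pendent paths; the iterates with
  \<open>i < r\<close> are the path vertices without the vertex of attachment. The exact counts in
  \<open>path_card\<close> express that nothing else hangs on a path.\<close>

locale rooted_tree_with_paths = rooted_tree +
  fixes L :: "'a set" and r :: nat
  assumes L_subset: "L \<subseteq> verts G"
    and path_nonroot: "\<And>l i. l \<in> L \<Longrightarrow> i < r \<Longrightarrow> (p ^^ i) l \<noteq> c"
    and path_card: "\<And>l i. l \<in> L \<Longrightarrow> i < r \<Longrightarrow> card (D ((p ^^ i) l)) = Suc i"
    and r_pos: "1 \<le> r"
begin

definition Hang :: "'a set" where
  "Hang = (\<lambda>(l, i). (p ^^ i) l) ` (L \<times> {..<r})"

definition W :: "'a set" where
  "W = verts G - Hang"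

text \<open>Both sides of a core edge have this property. It makes the size of a side depend only on
  its core vertices and on the number of paths in it.\<close>

definition path_closed :: "'a set \<Rightarrow> bool" where
  "path_closed Z \<longleftrightarrow> Z \<subseteq> verts G \<and> (\<forall>l\<in>L. \<forall>i<r. (p ^^ i) l \<in> Z \<longleftrightarrow> l \<in> Z)"

lemma L_in [simp]: "l \<in> L \<Longrightarrow> l \<in> verts G"
  using L_subset by blast

lemma finite_L [simp]: "finite L"
  using L_subset fin finite_subset by blast

lemma W_subset: "W \<subseteq> verts G"
  by (auto simp: W_def)

lemma W_in [simp]: "w \<in> W \<Longrightarrow> w \<in> verts G"
  by (auto simp: W_def)

lemma finite_W [simp]: "finite W"
  by (simp add: W_def)

lemma Hang_in [simp]: "x \<in> Hang \<Longrightarrow> x \<in> verts G"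
  by (auto simp: Hang_def)

lemma HangI: "l \<in> L \<Longrightarrow> i < r \<Longrightarrow> (p ^^ i) l \<in> Hang"
  by (auto simp: Hang_def)

lemma HangE:
  assumes "x \<in> Hang"
  obtains l i where "l \<in> L" "i < r" "x = (p ^^ i) l"
  using assms by (auto simp: Hang_def)

text \<open>The iterates up to \<open>i\<close> are \<open>i + 1\<close> distinct descendants, and
  \<open>path_card\<close> leaves room for no others.\<close>

lemma D_path:
  assumes "l \<in> L" "i < r"
  shows "D ((p ^^ i) l) = (\<lambda>j. (p ^^ j) l) ` {..i}"
proof -
  have "inj_on (\<lambda>j. (p ^^ j) l) {..i}"
  proof (rule inj_onI)
    fix j k
    assume "j \<in> {..i}" "k \<in> {..i}" and eq: "(p ^^ j) l = (p ^^ k) l"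
    then have "j < r" "k < r" using assms(2) by simp_all
    then have "card (D ((p ^^ j) l)) = Suc j" "card (D ((p ^^ k) l)) = Suc k"
      using path_card[OF assms(1)] by blast+
    then show "j = k" unfolding eq by simp
  qed
  then have "card ((\<lambda>j. (p ^^ j) l) ` {..i}) = Suc i" by (simp add: card_image)
  moreover have "(\<lambda>j. (p ^^ j) l) ` {..i} \<subseteq> D ((p ^^ i) l)"
  proof
    fix x
    assume "x \<in> (\<lambda>j. (p ^^ j) l) ` {..i}"
    then obtain j where j: "j \<le> i" "x = (p ^^ j) l" by auto
    then have "(p ^^ (i - j)) x = (p ^^ i) l"
      by (metis comp_apply funpow_add le_add_diff_inverse2)
    then show "x \<in> D ((p ^^ i) l)" using D_funpow[of x "i - j"] j assms by simp
  qed
  ultimately show ?thesis using path_card[OF assms] card_subset_eq[OF D_finite] by metis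
qed

lemma D_Hang: "x \<in> Hang \<Longrightarrow> y \<in> D x \<Longrightarrow> y \<in> Hang"
proof (elim HangE)
  fix l i
  assume "y \<in> D x" "l \<in> L" "i < r" "x = (p ^^ i) l"
  then have "y \<in> (\<lambda>j. (p ^^ j) l) ` {..i}" using D_path by simp
  then obtain j where "j \<le> i" "y = (p ^^ j) l" by auto
  then show "y \<in> Hang" using HangI \<open>l \<in> L\<close> \<open>i < r\<close> by simp
qed

text \<open>Disjointness of the paths is a consequence of \<open>path_card\<close>: the number of
  descendants reveals the position of a vertex on any path through it, and position 0 below a common
  vertex identifies the leaf.\<close>

lemma inj_on_paths: "inj_on (\<lambda>(l, i). (p ^^ i) l) (L \<times> {..<r})"
proof (rule inj_onI, clarify)
  fix l i l' i'
  assume l: "l \<in> L" "l' \<in> L" and i: "i < r" "i' < r" and eq: "(p ^^ i) l = (p ^^ i') l'"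
  have "Suc i = Suc i'" using path_card[OF l(1) i(1)] path_card[OF l(2) i(2)] eq by simp
  moreover have "l \<in> D ((p ^^ i') l')" using D_funpow[of l i] l eq by simp
  then obtain j where j: "j \<le> i'" "l = (p ^^ j) l'" using D_path[OF l(2) i(2)] by auto
  then have "Suc 0 = Suc j" using path_card[OF l(1), of 0] path_card[OF l(2), of j] i by auto
  ultimately show "l = l' \<and> i = i'" using j by simp
qed

lemma root_in_W [simp]: "c \<in> W"
  using path_nonroot by (auto simp: W_def Hang_def)

lemma parent_in_W: "w \<in> W \<Longrightarrow> p w \<in> W"
  using D_Hang[of "p w" w] D_funpow[of w 1] by (auto simp: W_def)

lemma funpow_in_W: "w \<in> W \<Longrightarrow> (p ^^ i) w \<in> W"
  by (induction i) (auto simp: parent_in_W)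

text \<open>Below a path vertex there are only path vertices. If a leaf \<open>l\<close> lies in
  \<open>D v\<close>, then \<open>v\<close> and any path vertex above \<open>l\<close> are
  comparable, and the core vertex \<open>v\<close> must be the upper one.\<close>

lemma path_closed_D:
  assumes "v \<in> W"
  shows "path_closed (D v)"
  unfolding path_closed_def
proof (intro conjI ballI allI impI D_subset)
  fix l i
  assume l: "l \<in> L" "i < r"
  have li: "l \<in> D ((p ^^ i) l)" using l by (simp add: D_funpow)
  show "(p ^^ i) l \<in> D v \<longleftrightarrow> l \<in> D v"
  proof
    assume "(p ^^ i) l \<in> D v"
    then show "l \<in> D v" using li by (rule D_trans)
  next
    assume "l \<in> D v"
    then have "(p ^^ i) l \<in> D v \<or> v \<in> D ((p ^^ i) l)" by (rule D_comparable[OF li])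
    moreover have "v \<notin> D ((p ^^ i) l)" using D_Hang[OF HangI[OF l]] assms by (auto simp: W_def)
    ultimately show "(p ^^ i) l \<in> D v" by blast
  qed
qed

lemma path_closed_diff: "path_closed Z \<Longrightarrow> path_closed (verts G - Z)"
  by (auto simp: path_closed_def)

lemma card_path_closed:
  assumes "path_closed Z"
  shows "card Z = card (Z \<inter> W) + r * card (Z \<inter> L)"
proof -
  have Z: "Z \<subseteq> verts G"
    and iff: "\<And>l i. l \<in> L \<Longrightarrow> i < r \<Longrightarrow> (p ^^ i) l \<in> Z \<longleftrightarrow> l \<in> Z"
    using assms by (auto simp: path_closed_def)
  then have "finite Z" using fin finite_subset by blast
  have "Z \<inter> Hang = (\<lambda>(l, i). (p ^^ i) l) ` ((Z \<inter> L) \<times> {..<r})"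
    unfolding Hang_def by (auto simp: iff)
  moreover have "inj_on (\<lambda>(l, i). (p ^^ i) l) ((Z \<inter> L) \<times> {..<r})"
    by (rule inj_on_subset[OF inj_on_paths]) auto
  ultimately have "card (Z \<inter> Hang) = r * card (Z \<inter> L)"
    by (simp add: card_image card_cartesian_product)
  moreover have "card Z = card (Z \<inter> W) + card (Z \<inter> Hang)"
  proof -
    have "Z = (Z \<inter> W) \<union> (Z \<inter> Hang)" "(Z \<inter> W) \<inter> (Z \<inter> Hang) = {}" using Z by (auto simp: W_def)
    then show ?thesis using card_Un_disjoint[of "Z \<inter> W" "Z \<inter> Hang"] \<open>finite Z\<close> by simp
  qed
  ultimately show ?thesis by simp
qed

lemma card_verts: "card (verts G) = card W + r * card L"
proof -
  have "path_closed (verts G)" by (simp add: path_closed_def)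
  from card_path_closed[OF this] show ?thesis
    using L_subset W_subset by (simp add: Int_absorb1)
qed

section \<open>Bounds on the number of core edges with two large sides\<close>

lemma ex_lowest:
  assumes "F \<subseteq> verts G" "F \<noteq> {}"
  shows "\<exists>v\<in>F. \<forall>w\<in>F. h w \<le> h v"
proof -
  have fF: "finite F" using assms fin finite_subset by blast
  have "Max (h ` F) \<in> h ` F" using fF assms by auto
  then obtain v where v: "v \<in> F" "h v = Max (h ` F)" by auto
  moreover have "h w \<le> Max (h ` F)" if "w \<in> F" for w using fF that by simp
  ultimately show ?thesis by metis
qed

lemma ex_topmost:
  assumes "F \<noteq> {}"
  shows "\<exists>u\<in>F. \<forall>w\<in>F. h u \<le> h w"
  using ex_has_least_nat[of "\<lambda>w. w \<in> F" _ h] assms by blast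

lemma D_disjoint: "v \<notin> D w \<Longrightarrow> w \<notin> D v \<Longrightarrow> D v \<inter> D w = {}"
  using D_comparable by blast

lemma lowest_D:
  assumes "v \<in> F" "F \<subseteq> verts G" "\<And>w. w \<in> F \<Longrightarrow> w \<in> D v \<Longrightarrow> h w \<le> h v"
  shows "F \<inter> D v = {v}"
  using assms D_height[of _ v] by (auto simp: not_le[symmetric])

text \<open>The edges whose two sides both contain at least \<open>t\<close> vertices form a subtree, represented
  here by the set \<open>F\<close> of their lower ends. Two extremal edges of this subtree cut off disjoint
  sides that contain no further edges of it.\<close>

lemma two_disjoint_sides:
  assumes F: "F \<subseteq> W - {c}" "F \<noteq> {}"
    and t: "\<And>v. v \<in> F \<Longrightarrow> t \<le> card (D v) \<and> t + card (D v) \<le> card (verts G)"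
  shows "\<exists>Y Z. path_closed Y \<and> path_closed Z \<and> Y \<inter> Z = {} \<and> t \<le> card Y \<and> t \<le> card Z \<and>
    1 \<le> card (Y \<inter> W) \<and> 1 \<le> card (Z \<inter> W) \<and>
    card F + card (Y \<inter> W) + card (Z \<inter> W) \<le> card W + 1"
proof -
  have FV: "F \<subseteq> verts G" and fF: "finite F"
    using F W_subset fin finite_subset[OF _ fin] by blast+
  obtain v where v: "v \<in> F" "\<And>w. w \<in> F \<Longrightarrow> h w \<le> h v" using ex_lowest[OF FV F(2)] by blast
  have Dv: "F \<inter> D v = {v}" using lowest_D[OF v(1) FV] v(2) by blast
  have vW: "v \<in> W" using v F by auto
  have pos: "1 \<le> card (X \<inter> W)" if "x \<in> X" "x \<in> W" for X x
    using that card_gt_0_iff[of "X \<inter> W"] by auto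
  define I where "I = {w \<in> F. w \<notin> D v \<and> v \<notin> D w}"
  show ?thesis
  proof (cases "I = {}")
    case False
    obtain w where w: "w \<in> I" "\<And>x. x \<in> I \<Longrightarrow> h x \<le> h w"
      using ex_lowest[OF _ False] FV by (auto simp: I_def)
    have wF: "w \<in> F" "w \<notin> D v" "v \<notin> D w" "w \<in> W" using w F by (auto simp: I_def)
    have disj: "D v \<inter> D w = {}" using D_disjoint wF by blast
    have Dw: "F \<inter> D w = {w}"
    proof (rule lowest_D[OF wF(1) FV])
      fix x
      assume x: "x \<in> F" "x \<in> D w"
      have "x \<notin> D v" using x disj by blast
      moreover have "v \<notin> D x" using x wF D_trans by blast
      ultimately show "h x \<le> h w" using w(2) x by (simp add: I_def)
    qed
    \<comment> \<open>The excluded root and the two surplus elements \<open>v\<close> and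
      \<open>w\<close> balance to the \<open>+ 1\<close> of the claim. In the other case the root
      lies in the second side and only \<open>v\<close> is surplus, with the same result.\<close>
    have "F \<subseteq> (W - {c} - (D v \<inter> W) - (D w \<inter> W)) \<union> {v, w}" using F Dv Dw by auto
    then have "card F \<le> card ((W - {c} - (D v \<inter> W) - (D w \<inter> W)) \<union> {v, w})"
      by (intro card_mono) auto
    also have "\<dots> \<le> card (W - {c} - (D v \<inter> W) - (D w \<inter> W)) + card {v, w}" by (rule card_Un_le)
    also have "card {v, w} \<le> 2" by (simp add: card_insert_if)
    finally have "card F \<le> card (W - {c} - (D v \<inter> W) - (D w \<inter> W)) + 2" by simp
    moreover have "card (W - {c} - (D v \<inter> W) - (D w \<inter> W)) + card (D v \<inter> W) + card (D w \<inter> W) = card (W - {c})"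
      using disj root_in_D v wF F by (intro card_Diff_Diff) auto
    moreover have "card (W - {c}) + 1 = card W" using card_Suc_Diff1[of W c] by simp
    ultimately have "card F + card (D v \<inter> W) + card (D w \<inter> W) \<le> card W + 1" by simp
    then show ?thesis
      using path_closed_D[OF vW] path_closed_D[OF wF(4)] disj t[OF v(1)] t[OF wF(1)]
        pos[of v "D v"] pos[of w "D w"] vW wF by (intro exI[of _ "D v"] exI[of _ "D w"]) auto
  next
    case True
    obtain u where u: "u \<in> F" "\<And>w. w \<in> F \<Longrightarrow> h u \<le> h w" using ex_topmost[OF F(2)] by blast
    have uW: "u \<in> W" "u \<noteq> c" using u F by auto
    have chain: "v \<in> D w" if "w \<in> F" for w
    proof (cases "w = v")
      case False
      then have "w \<notin> D v" using Dv that by blast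
      then show ?thesis using True that by (auto simp: I_def)
    qed (use vW in simp)
    have below: "w \<in> D u" if "w \<in> F" for w
    proof -
      have "w \<in> D u \<or> u \<in> D w" using D_comparable chain that u(1) by blast
      then show ?thesis using D_height[of u w] u(2)[OF that] uW by (cases "u = w") auto
    qed
    \<comment> \<open>All edges of \<open>F\<close> lie on the way from \<open>v\<close> to the root
      here, so the second extremal edge is the topmost one, and its outer side is the one containing
      the root.\<close>
    let ?Z = "verts G - D u"
    have "F \<subseteq> (W - (D v \<inter> W) - (?Z \<inter> W)) \<union> {v}" using F Dv below by auto
    then have "card F \<le> card ((W - (D v \<inter> W) - (?Z \<inter> W)) \<union> {v})"
      by (intro card_mono) auto
    also have "\<dots> \<le> card (W - (D v \<inter> W) - (?Z \<inter> W)) + card {v}" by (rule card_Un_le)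
    finally have "card F \<le> card (W - (D v \<inter> W) - (?Z \<inter> W)) + 1" by simp
    moreover have disj: "D v \<inter> ?Z = {}" using D_mono[OF chain[OF u(1)]] by blast
    then have "card (W - (D v \<inter> W) - (?Z \<inter> W)) + card (D v \<inter> W) + card (?Z \<inter> W) = card W"
      by (intro card_Diff_Diff) auto
    ultimately have "card F + card (D v \<inter> W) + card (?Z \<inter> W) \<le> card W + 1" by simp
    moreover have "card ?Z = card (verts G) - card (D u)" by (simp add: card_Diff_subset D_subset)
    then have "t \<le> card ?Z" using t[OF u(1)] by linarith
    moreover have "1 \<le> card (?Z \<inter> W)" using pos[of c ?Z] root_in_D uW by auto
    ultimately show ?thesis
      using path_closed_D[OF vW] path_closed_diff[OF path_closed_D[OF uW(1)]] disj t[OF v(1)]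
        pos[of v "D v"] vW by (intro exI[of _ "D v"] exI[of _ ?Z]) auto
  qed
qed

text \<open>Adding \<open>t \<le> card Y\<close> and \<open>t \<le> card Z\<close> for the two
  disjoint sides gives the first bound. For the second, one side meets at most \<open>b\<close>
  paths and so contains at least \<open>t - r * b\<close> core vertices, while the other side
  contains at least one.\<close>

lemma card_thick_edges_le:
  assumes F: "F \<subseteq> W - {c}" "F \<noteq> {}"
    and t: "\<And>v. v \<in> F \<Longrightarrow> t \<le> card (D v) \<and> t + card (D v) \<le> card (verts G)"
    and b: "card L \<le> 2 * b + 1"
  shows "card F + 2 * t \<le> card (verts G) + 1" and "card F + t \<le> card W + r * b"
proof -
  obtain Y Z where c: "path_closed Y" "path_closed Z" and disj: "Y \<inter> Z = {}" and YZ: "t \<le> card Y" "t \<le> card Z"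
    "1 \<le> card (Y \<inter> W)" "1 \<le> card (Z \<inter> W)" "card F + card (Y \<inter> W) + card (Z \<inter> W) \<le> card W + 1"
    using two_disjoint_sides[OF F t] by blast
  have "card (Y \<inter> L) + card (Z \<inter> L) = card ((Y \<inter> L) \<union> (Z \<inter> L))"
    using disj by (intro card_Un_disjoint[symmetric]) auto
  also have "\<dots> \<le> card L" by (rule card_mono) auto
  finally have L: "card (Y \<inter> L) + card (Z \<inter> L) \<le> card L" .
  then have "r * card (Y \<inter> L) + r * card (Z \<inter> L) \<le> r * card L"
    by (metis add_mult_distrib2 mult_le_mono2)
  then show "card F + 2 * t \<le> card (verts G) + 1"
    using YZ card_path_closed[OF c(1)] card_path_closed[OF c(2)] card_verts by linarith
  have "card (Y \<inter> L) \<le> b \<or> card (Z \<inter> L) \<le> b" using L b by linarith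
  then have "r * card (Y \<inter> L) \<le> r * b \<or> r * card (Z \<inter> L) \<le> r * b" by auto
  then show "card F + t \<le> card W + r * b"
    using YZ card_path_closed[OF c(1)] card_path_closed[OF c(2)] by linarith
qed

text \<open>The second summand depends only on the order, on \<open>r\<close> and on
  \<open>card L\<close>, so it cancels when two trees are compared.\<close>

lemma sum_paths_and_rest:
  "mostar_index G = (\<Sum>v\<in>W - {c}. \<bar>int (card (verts G)) - 2 * int (card (D v))\<bar>)
    + int (card L) * (\<Sum>i<r. \<bar>int (card (verts G)) - 2 * int (Suc i)\<bar>)"
proof -
  let ?f = "\<lambda>d. \<bar>int (card (verts G)) - 2 * int d\<bar>"
  have "verts G - {c} = (W - {c}) \<union> Hang" using root_in_W by (auto simp: W_def)
  then have "mostar_index G = (\<Sum>v\<in>(W - {c}) \<union> Hang. ?f (card (D v)))"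
    by (simp add: mostar_index_eq)
  also have "\<dots> = (\<Sum>v\<in>W - {c}. ?f (card (D v))) + (\<Sum>v\<in>Hang. ?f (card (D v)))"
    by (rule sum.union_disjoint) (auto simp: W_def Hang_def)
  also have "(\<Sum>v\<in>Hang. ?f (card (D v))) = (\<Sum>(l, i)\<in>L \<times> {..<r}. ?f (Suc i))"
    unfolding Hang_def by (subst sum.reindex[OF inj_on_paths]) (auto intro!: sum.cong simp: path_card)
  also have "\<dots> = int (card L) * (\<Sum>i<r. ?f (Suc i))"
    by (simp flip: sum.cartesian_product)
  finally show ?thesis .
qed

end

section \<open>Shape of the core in the case of equality\<close>

context rooted_tree_with_paths
begin

text \<open>Otherwise the last path vertex would lie below a path vertex, hence by disjointness
  below a vertex of its own path, and would have to be its own parent.\<close>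

lemma path_top_in_W:
  assumes "l \<in> L"
  shows "(p ^^ r) l \<in> W"
proof (rule ccontr)
  assume "(p ^^ r) l \<notin> W"
  then have "(p ^^ r) l \<in> Hang" using assms by (simp add: W_def)
  then obtain l' j where j: "l' \<in> L" "j < r" "(p ^^ r) l = (p ^^ j) l'" by (rule HangE)
  obtain s where s: "r = Suc s" using r_pos by (cases r) auto
  have top: "p ((p ^^ s) l) = (p ^^ r) l" using s by simp
  then have "(p ^^ s) l \<in> D ((p ^^ r) l)" using D_funpow[of "(p ^^ s) l" 1] assms by simp
  then obtain i where i: "i \<le> j" "(p ^^ s) l = (p ^^ i) l'" using D_path[OF j(1,2)] j(3) by auto
  then have "(l, s) = (l', i)"
    using inj_onD[OF inj_on_paths, of "(l, s)" "(l', i)"] assms j s by auto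
  then have "p ((p ^^ s) l) = (p ^^ s) l" using i j s top by (simp add: less_Suc_eq_le)
  then show False using parent_neq[of "(p ^^ s) l"] path_nonroot[OF assms, of s] assms s by simp
qed

lemma path_top_in_D:
  assumes "l \<in> L" "v \<in> W" "l \<in> D v"
  shows "(p ^^ r) l \<in> D v"
proof -
  obtain s where s: "r = Suc s" using r_pos by (cases r) auto
  then have "s < r" by simp
  then have "(p ^^ s) l \<in> D v"
    using path_closed_D[OF assms(2)] assms(1,3) unfolding path_closed_def by blast
  moreover have "(p ^^ s) l \<noteq> v" using HangI[OF assms(1) \<open>s < r\<close>] assms(2) by (auto simp: W_def)
  ultimately show ?thesis using D_parent_iff[of "(p ^^ s) l" v] assms(1) s by simp
qed

text \<open>At least \<open>b\<close> paths are found below a core leaf, below a second core leaf if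
  there is one, and on the root side of the top core edge, the root being an end by
  \<open>end_root\<close>. As there are at most \<open>2 * b + 1\<close> paths, a second core leaf
  would leave exactly \<open>b\<close> paths at each leaf and contradict \<open>few\<close>; the
  same count leaves no path attached between the two ends.\<close>

lemma core_is_chain:
  assumes L: "card L = a + b" "b \<le> a" "a \<le> b + 1" "1 \<le> b"
    and end_root: "\<And>x y. x \<in> W - {c} \<Longrightarrow> y \<in> W - {c} \<Longrightarrow> p x = c \<Longrightarrow> p y = c \<Longrightarrow> x = y"
    and size: "\<And>v. v \<in> W - {c} \<Longrightarrow>
      r * b + 1 \<le> card (D v) \<and> r * b + 1 + card (D v) \<le> card (verts G)"
    and few: "\<And>x y. a = b + 1 \<Longrightarrow> x \<in> W - {c} \<Longrightarrow> y \<in> W - {c} \<Longrightarrow>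
      card (D x) = r * b + 1 \<or> r * b + 1 + card (D x) = card (verts G) \<Longrightarrow>
      card (D y) = r * b + 1 \<or> r * b + 1 + card (D y) = card (verts G) \<Longrightarrow> x = y"
  shows "\<exists>v L1 L2. v \<in> W \<and> (\<forall>w\<in>W. v \<in> D w) \<and> L1 \<union> L2 = L \<and> L1 \<inter> L2 = {} \<and>
    (\<forall>l\<in>L1. (p ^^ r) l = c) \<and> (\<forall>l\<in>L2. (p ^^ r) l = v) \<and>
    (card L1 = a \<and> card L2 = b \<or> card L1 = b \<and> card L2 = a)"
proof (cases "W = {c}")
  case True
  \<comment> \<open>With a one-vertex core all paths are attached at the root, so any split of the
    prescribed sizes will do, with \<open>c\<close> itself as \<open>v\<close>.\<close>
  obtain L1 where "L1 \<subseteq> L" "card L1 = a" using obtain_subset_with_card_n[of a L] L by auto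
  moreover from this have "card (L - L1) = b" using L finite_subset[of L1 L] by (simp add: card_Diff_subset)
  moreover have "(p ^^ r) l = c" if "l \<in> L" for l using path_top_in_W[OF that] True by simp
  ultimately show ?thesis using True by (intro exI[of _ c] exI[of _ L1] exI[of _ "L - L1"]) auto
next
  case False
  define V where "V = W - {c}"
  have V: "V \<noteq> {}" "V \<subseteq> verts G" "\<And>v. v \<in> V \<Longrightarrow> v \<in> W \<and> v \<noteq> c \<and> v \<in> verts G"
    using False root_in_W W_subset by (auto simp: V_def)
  obtain v where v: "v \<in> V" "\<And>w. w \<in> V \<Longrightarrow> h w \<le> h v" using ex_lowest[OF V(2,1)] by blast
  obtain u where u: "u \<in> V" "\<And>w. w \<in> V \<Longrightarrow> h u \<le> h w" using ex_topmost[OF V(1)] by blast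
  have "p u = c"
  proof (rule ccontr)
    assume "p u \<noteq> c"
    then have "p u \<in> V" using V(3)[OF u(1)] parent_in_W by (simp add: V_def)
    then show False using u(2)[of "p u"] parent[of u] V(3)[OF u(1)] by auto
  qed
  have below: "w \<in> D u" if "w \<in> V" for w
    using that
  proof (induction "h w" arbitrary: w rule: less_induct)
    case less
    show ?case
    proof (cases "p w = c")
      case True
      then have "w = u" using end_root[of w u] less.prems u(1) \<open>p u = c\<close> by (simp add: V_def)
      then show ?thesis using V(3)[OF u(1)] by simp
    next
      case False
      have w: "w \<in> verts G" "w \<noteq> c" using V(3)[OF less.prems] by auto
      have "p w \<in> V" using False V(3)[OF less.prems] parent_in_W by (simp add: V_def)
      then have "p w \<in> D u" using less.hyps parent[OF w] by blast
      then show ?thesis using D_trans D_funpow[OF w(1), of 1] by simp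
    qed
  qed
  have cancel: "b \<le> y" if "r * b + 1 \<le> 1 + r * y" for y
    using that r_pos by simp
  have bottom: "card (D x) = 1 + r * card (D x \<inter> L)" "b \<le> card (D x \<inter> L)"
    if x: "x \<in> V" "V \<inter> D x = {x}" for x
  proof -
    have "D x \<inter> W = {x}" using x V(3)[OF x(1)] root_in_D[of x] by (auto simp: V_def)
    then show "card (D x) = 1 + r * card (D x \<inter> L)"
      using card_path_closed[OF path_closed_D] V(3)[OF x(1)] by simp
    moreover have "r * b + 1 \<le> card (D x)" using size[of x] x(1) by (simp add: V_def)
    ultimately show "b \<le> card (D x \<inter> L)" by (intro cancel) simp
  qed
  \<comment> \<open>The root side of the top core edge. Its only core vertex is \<open>c\<close>, so
    its size counts its paths exactly as below a core leaf.\<close>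
  let ?U = "verts G - D u"
  have uV: "u \<in> W" "u \<noteq> c" "u \<in> verts G" using V(3)[OF u(1)] by auto
  have "?U \<inter> W = {c}" using below root_in_D[of u] uV by (auto simp: V_def)
  then have "card ?U = 1 + r * card (?U \<inter> L)"
    using card_path_closed[OF path_closed_diff[OF path_closed_D[OF uV(1)]]] by simp
  moreover have "card ?U + card (D u) = card (verts G)"
    using card_D_le[of u] by (simp add: card_Diff_subset D_subset)
  ultimately have top: "1 + r * card (?U \<inter> L) + card (D u) = card (verts G)" by simp
  moreover have "r * b + 1 + card (D u) \<le> card (verts G)" using size[of u] u(1) by (simp add: V_def)
  ultimately have top_b: "b \<le> card (?U \<inter> L)" by (intro cancel) linarith
  have Dv: "V \<inter> D v = {v}" using lowest_D[OF v(1) V(2)] v(2) by blast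
  have vW: "v \<in> W" "v \<noteq> c" "v \<in> verts G" using V(3)[OF v(1)] by auto
  have vu: "D v \<subseteq> D u" using D_mono below v(1) by blast
  have thin: "x = y" if "a = b + 1" "x \<in> V" "y \<in> V"
    "card (D x) = 1 + r * b \<or> 1 + r * b + card (D x) = card (verts G)"
    "card (D y) = 1 + r * b \<or> 1 + r * b + card (D y) = card (verts G)" for x y
    using few[of x y] that by (simp add: V_def)
  have chain: "v \<in> D w" if "w \<in> V" for w
  proof (rule ccontr)
    assume "v \<notin> D w"
    define I where "I = {w \<in> V. w \<notin> D v \<and> v \<notin> D w}"
    have "w \<noteq> v" using \<open>v \<notin> D w\<close> vW by auto
    then have "w \<in> I" using \<open>v \<notin> D w\<close> that Dv by (auto simp: I_def)
    then obtain x where x: "x \<in> I" "\<And>y. y \<in> I \<Longrightarrow> h y \<le> h x"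
      using ex_lowest[of I] V(2) by (auto simp: I_def)
    have xV: "x \<in> V" "x \<notin> D v" "v \<notin> D x" "x \<noteq> v" using x(1) vW by (auto simp: I_def)
    have disj: "D v \<inter> D x = {}" using D_disjoint xV by blast
    have Dx: "V \<inter> D x = {x}"
    proof (rule lowest_D[OF xV(1) V(2)])
      fix y
      assume y: "y \<in> V" "y \<in> D x"
      have "y \<notin> D v" using y disj by blast
      moreover have "v \<notin> D y" using y xV D_trans by blast
      ultimately show "h y \<le> h x" using x(2) y by (simp add: I_def)
    qed
    have "D x \<subseteq> D u" using D_mono below xV(1) by blast
    then have "card ((D v \<inter> L) \<union> (D x \<inter> L) \<union> (?U \<inter> L)) =
      card (D v \<inter> L) + card (D x \<inter> L) + card (?U \<inter> L)"
      using disj vu by (subst card_Un_disjoint, simp, simp, blast, subst card_Un_disjoint, simp, simp, blast, simp)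
    moreover have "card ((D v \<inter> L) \<union> (D x \<inter> L) \<union> (?U \<inter> L)) \<le> card L"
      by (rule card_mono) auto
    moreover note bottom(2)[OF v(1) Dv] bottom(2)[OF xV(1) Dx] top_b
    ultimately have "a = b + 1" "card (D v \<inter> L) = b" "card (D x \<inter> L) = b" using L by linarith+
    then show False using thin[of v x] bottom(1)[OF v(1) Dv] bottom(1)[OF xV(1) Dx] v(1) xV by simp
  qed
  have vL: "b \<le> card (D v \<inter> L)" "card (D v) = 1 + r * card (D v \<inter> L)" using bottom[OF v(1) Dv] by auto
  have disj: "(?U \<inter> L) \<inter> (D v \<inter> L) = {}" using vu by blast
  then have card_Un: "card ((?U \<inter> L) \<union> (D v \<inter> L)) = card (?U \<inter> L) + card (D v \<inter> L)"
    by (intro card_Un_disjoint) auto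
  have Un: "(?U \<inter> L) \<union> (D v \<inter> L) = L"
  proof (cases "u = v")
    case True
    then show ?thesis using L_subset by blast
  next
    case False
    \<comment> \<open>Exactly \<open>b\<close> paths at both ends would make the two end edges thin,
      and \<open>few\<close> would identify them.\<close>
    have "\<not> (a = b + 1 \<and> card (?U \<inter> L) = b \<and> card (D v \<inter> L) = b)"
      using thin[of u v] False u(1) v(1) vL(2) top by auto
    then have "card L \<le> card ((?U \<inter> L) \<union> (D v \<inter> L))"
      unfolding card_Un using L vL(1) top_b by linarith
    then show ?thesis by (intro card_seteq) auto
  qed
  have top_end: "(p ^^ r) l = c" if "l \<in> ?U \<inter> L" for l
  proof (rule ccontr)
    assume "(p ^^ r) l \<noteq> c"
    then have "(p ^^ r) l \<in> D u" using below path_top_in_W that by (simp add: V_def)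
    then show False using D_trans D_funpow[of l r] that by blast
  qed
  have bottom_end: "(p ^^ r) l = v" if "l \<in> D v \<inter> L" for l
  proof -
    have l: "l \<in> L" "l \<in> D v" using that by auto
    have "(p ^^ r) l \<in> D v" using path_top_in_D[OF l(1) vW(1) l(2)] .
    moreover from this have "(p ^^ r) l \<noteq> c" using root_in_D vW by metis
    ultimately show ?thesis using Dv path_top_in_W[OF l(1)] by (auto simp: V_def)
  qed
  have all_above: "v \<in> D w" if "w \<in> W" for w using chain in_D_root[OF vW(3)] that by (cases "w = c") (auto simp: V_def)
  have cards: "card (?U \<inter> L) = a \<and> card (D v \<inter> L) = b \<or> card (?U \<inter> L) = b \<and> card (D v \<inter> L) = a"
    using Un card_Un L vL(1) top_b by auto
  show ?thesis
    by (rule exI[of _ v], rule exI[of _ "?U \<inter> L"], rule exI[of _ "D v \<inter> L"], intro conjI ballI)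
      (rule vW(1) Un disj cards | (rule all_above top_end bottom_end, assumption))+
qed

text \<open>The root \<open>c\<close> plays the role of \<open>Spine 1\<close> and \<open>v\<close>
  that of \<open>Spine m\<close>; a leaf in \<open>L\<close> becomes the outer end
  \<open>Branch i r\<close> of its branch. The map goes from the model tree onto
  \<open>verts G\<close>, so injectivity follows from the equality of the orders.\<close>

lemma chain_iso_A_graph:
  assumes v: "v \<in> W" "\<And>w. w \<in> W \<Longrightarrow> v \<in> D w"
    and L: "L1 \<union> L2 = L" "L1 \<inter> L2 = {}" "card L1 = a" "card L2 = b"
    and ends: "\<And>l. l \<in> L1 \<Longrightarrow> (p ^^ r) l = c" "\<And>l. l \<in> L2 \<Longrightarrow> (p ^^ r) l = v"
    and n: "card (verts G) = n" and simple: "simple_graph (A_graph r n a b)"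
  shows "G \<cong>\<^sub>g A_graph r n a b"
proof -
  have finL: "finite L1" "finite L2" using L(1) finite_L by (metis finite_Un)+
  have cardL: "card L = a + b" using L finL card_Un_disjoint by blast
  define m where "m = n - (a + b) * r"
  have m: "m = card W" using card_verts cardL n by (simp add: m_def mult.commute)
  have le: "(a + b) * r \<le> n" using card_verts cardL n by (simp add: mult.commute)
  obtain N where N: "(p ^^ N) v = c" and below_N: "\<And>i. i < N \<Longrightarrow> (p ^^ i) v \<noteq> c"
    and after_N: "\<And>i. N \<le> i \<Longrightarrow> (p ^^ i) v = c"
    using ex_root_distance[OF W_in[OF v(1)]] by blast
  have inj: "inj_on (\<lambda>i. (p ^^ i) v) {..N}"
  proof (rule inj_onI)
    fix i j
    assume "i \<in> {..N}" "j \<in> {..N}" and eq: "(p ^^ i) v = (p ^^ j) v"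
    then have "i \<le> N" "j \<le> N" by auto
    then show "i = j"
      using funpow_inj[OF W_in[OF v(1)] _ _ below_N eq] funpow_inj[OF W_in[OF v(1)] _ _ below_N eq[symmetric]]
        nat_le_linear[of i j] by metis
  qed
  have W_eq: "W = (\<lambda>i. (p ^^ i) v) ` {..N}"
  proof (intro equalityI subsetI)
    fix w
    assume "w \<in> W"
    then obtain i where "(p ^^ i) v = w" using v(2) by (auto simp: D_def)
    then have "w = (p ^^ (if i \<le> N then i else N)) v" using after_N[of i] N by simp
    then show "w \<in> (\<lambda>i. (p ^^ i) v) ` {..N}" by (rule image_eqI) simp
  qed (use funpow_in_W v(1) in auto)
  then have "card W = Suc N" using card_image[OF inj] by simp
  then have mN: "m = Suc N" using m by simp
  obtain g1 where g1: "bij_betw g1 {1..a} L1"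
    using finite_same_card_bij[of "{1..a}" L1] finL L by auto
  obtain g2 where g2: "bij_betw g2 {a + 1..a + b} L2"
    using finite_same_card_bij[of "{a + 1..a + b}" L2] finL L by auto
  define g where "g i = (if i \<le> a then g1 i else g2 i)" for i
  have gL1: "g ` {1..a} = L1" using g1 unfolding bij_betw_def g_def by auto
  have gL2: "g ` {a + 1..a + b} = L2"
  proof -
    have "g ` {a + 1..a + b} = g2 ` {a + 1..a + b}" by (rule image_cong) (auto simp: g_def)
    then show ?thesis using g2 by (simp add: bij_betw_def)
  qed
  have "{1..a + b} = {1..a} \<union> {a + 1..a + b}" by auto
  then have gL: "g ` {1..a + b} = L" using gL1 gL2 L(1) by (simp only: image_Un)
  have gin: "g i \<in> L" if "i \<in> {1..a + b}" for i using gL that by blast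
  define f where "f x = (case x of Spine i \<Rightarrow> (p ^^ (m - i)) v | Branch i j \<Rightarrow> (p ^^ (r - j)) (g i))" for x
  let ?A = "A_graph r n a b"
  have fS: "f (Spine i) = (p ^^ (m - i)) v" and fB: "f (Branch i j) = (p ^^ (r - j)) (g i)" for i j
    by (simp_all add: f_def)
  have spine: "(\<lambda>i. f (Spine i)) ` {1..m} = W"
  proof -
    have "(\<lambda>i. m - i) ` {1..m} = {..N}"
    proof (intro equalityI subsetI)
      fix i
      assume "i \<in> {..N}"
      then show "i \<in> (\<lambda>i. m - i) ` {1..m}" using mN by (intro image_eqI[of _ _ "m - i"]) auto
    qed (use mN in auto)
    then have "(\<lambda>i. (p ^^ i) v) ` (\<lambda>i. m - i) ` {1..m} = W" using W_eq by simp
    then show ?thesis by (simp add: image_image fS)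
  qed
  have branch: "(\<lambda>(i, j). f (Branch i j)) ` ({1..a + b} \<times> {1..r}) = Hang"
  proof (intro equalityI subsetI)
    fix x
    assume "x \<in> Hang"
    then obtain l k where lk: "l \<in> L" "k < r" "x = (p ^^ k) l" by (rule HangE)
    then obtain i where i: "i \<in> {1..a + b}" "l = g i" using gL by blast
    then have "x = (\<lambda>(i, j). f (Branch i j)) (i, r - k)" using lk by (simp add: fB)
    moreover have "(i, r - k) \<in> {1..a + b} \<times> {1..r}" using i lk by simp
    ultimately show "x \<in> (\<lambda>(i, j). f (Branch i j)) ` ({1..a + b} \<times> {1..r})" by (rule image_eqI)
  next
    fix x
    assume "x \<in> (\<lambda>(i, j). f (Branch i j)) ` ({1..a + b} \<times> {1..r})"
    then obtain i j where "i \<in> {1..a + b}" "j \<in> {1..r}" "x = f (Branch i j)" by auto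
    then show "x \<in> Hang" using HangI[OF gin, of i "r - j"] by (simp add: fB)
  qed
  have "f ` verts ?A = (\<lambda>i. f (Spine i)) ` {1..m} \<union> (\<lambda>(i, j). f (Branch i j)) ` ({1..a + b} \<times> {1..r})"
    unfolding verts_A_graph image_Un image_image m_def by (simp add: case_prod_unfold)
  also have "\<dots> = verts G" unfolding spine branch by (auto simp: W_def)
  finally have surj: "f ` verts ?A = verts G" .
  have "finite (verts ?A)" "card (verts ?A) = card (verts G)"
    using simple order_A_graph[OF le] n by (auto simp: simple_graph_def order_def)
  then have inj_f: "inj_on f (verts ?A)" using surj by (intro eq_card_imp_inj_on) simp_all
  have step: "{(p ^^ Suc i) x, (p ^^ i) x} \<in> edges G" if "x \<in> verts G" "(p ^^ i) x \<noteq> c" for i x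
    using parent_edge[of "(p ^^ i) x"] that by (simp add: insert_commute)
  have path_step: "{(p ^^ Suc k) (g i), (p ^^ k) (g i)} \<in> edges G" if "i \<in> {1..a + b}" "k < r" for i k
    using step[of "g i" k] gin[OF that(1)] path_nonroot that by simp
  have "(`) f ` edges ?A = edges G"
  proof (intro equalityI subsetI)
    fix e
    assume "e \<in> (`) f ` edges ?A"
    then obtain d where d: "d \<in> edges ?A" "e = f ` d" by auto
    then consider i where "1 \<le> i" "Suc i \<le> m" "d = {Spine i, Spine (Suc i)}"
      | i j where "i \<in> {1..a + b}" "1 \<le> j" "Suc j \<le> r" "d = {Branch i j, Branch i (Suc j)}"
      | i where "i \<in> {1..a}" "d = {Spine 1, Branch i 1}"
      | i where "i \<in> {a + 1..a + b}" "d = {Spine m, Branch i 1}"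
      unfolding A_graph_def Let_def m_def by auto
    then show "e \<in> edges G"
    proof cases
      case 1
      then have "m - i = Suc (m - Suc i)" "m - Suc i < N" using mN by auto
      then have "e = {(p ^^ Suc (m - Suc i)) v, (p ^^ (m - Suc i)) v}" using d(2) 1 by (simp add: fS)
      then show ?thesis using step[OF W_in[OF v(1)] below_N[OF \<open>m - Suc i < N\<close>]] by simp
    next
      case 2
      then have "r - j = Suc (r - Suc j)" by auto
      then have "e = {(p ^^ Suc (r - Suc j)) (g i), (p ^^ (r - Suc j)) (g i)}"
        using d(2) 2 by (simp add: fB)
      then show ?thesis using path_step[of i "r - Suc j"] 2 by simp
    next
      case 3
      then have "(p ^^ r) (g i) = c" using ends(1) gL1 by blast
      moreover have "m - 1 = N" "r = Suc (r - 1)" using mN r_pos by auto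
      ultimately have "e = {(p ^^ Suc (r - 1)) (g i), (p ^^ (r - 1)) (g i)}"
        using d(2) 3 N by (simp add: fB fS)
      then show ?thesis using path_step[of i "r - 1"] 3 r_pos by simp
    next
      case 4
      then have "(p ^^ r) (g i) = v" using ends(2) gL2 by blast
      moreover have "r = Suc (r - 1)" using r_pos by auto
      ultimately have "e = {(p ^^ Suc (r - 1)) (g i), (p ^^ (r - 1)) (g i)}"
        using d(2) 4 by (simp add: fB fS)
      then show ?thesis using path_step[of i "r - 1"] 4 r_pos by simp
    qed
  next
    fix e
    assume "e \<in> edges G"
    then obtain x where x: "x \<in> verts G" "x \<noteq> c" "e = {x, p x}" by (auto simp: edges_eq)
    have "\<exists>d\<in>edges ?A. e = f ` d"
    proof (cases "x \<in> W")
      case True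
      then obtain k where k: "k \<le> N" "x = (p ^^ k) v" using W_eq by auto
      then have "k < N" using x(2) N by (cases "k = N") auto
      then have "m - (N - k) = Suc k" "m - Suc (N - k) = k" "1 \<le> N - k" "Suc (N - k) \<le> m" using mN by auto
      then show ?thesis
        using x(3) k(2) by (intro bexI[of _ "{Spine (N - k), Spine (Suc (N - k))}"])
          (auto simp: fS A_graph_def Let_def m_def)
    next
      case False
      then have "x \<in> Hang" using x(1) by (simp add: W_def)
      then obtain l k where lk: "l \<in> L" "k < r" "x = (p ^^ k) l" by (rule HangE)
      then obtain i where i: "i \<in> {1..a + b}" "l = g i" using gL by blast
      show ?thesis
      proof (cases "Suc k = r")
        case True
        then have px: "p x = (p ^^ r) (g i)" "r - 1 = k" using lk i by auto
        show ?thesis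
        proof (cases "i \<le> a")
          case True
          then have "p x = c" using px ends(1) gL1 i by auto
          moreover have "m - 1 = N" using mN by simp
          ultimately show ?thesis
            using x(3) lk i px(2) N True by (intro bexI[of _ "{Spine 1, Branch i 1}"])
              (auto simp: fS fB A_graph_def Let_def)
        next
          case False
          then have "p x = v" using px ends(2) gL2 i by auto
          then show ?thesis
            using x(3) lk i px(2) False by (intro bexI[of _ "{Spine m, Branch i 1}"])
              (auto simp: fS fB A_graph_def Let_def m_def)
        qed
      next
        case False
        then have "r - (r - Suc k) = Suc k" "r - Suc (r - Suc k) = k" "1 \<le> r - Suc k" "Suc (r - Suc k) \<le> r"
          using lk(2) by auto
        then show ?thesis
          using x(3) lk i by (intro bexI[of _ "{Branch i (r - Suc k), Branch i (Suc (r - Suc k))}"])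
            (auto simp: fB A_graph_def Let_def)
      qed
    qed
    then show "e \<in> (`) f ` edges ?A" by blast
  qed
  then show ?thesis using graph_isoI[OF simple inj_f surj] graph_iso_sym by blast
qed

end

section \<open>The extremal trees\<close>

definition A_parent :: "nat \<Rightarrow> nat \<Rightarrow> bvertex \<Rightarrow> bvertex" where
  "A_parent a m x = (case x of
     Spine i \<Rightarrow> if i < m then Spine (Suc i) else Spine i
   | Branch i j \<Rightarrow> if j \<le> 1 then (if i \<le> a then Spine 1 else Spine m) else Branch i (j - 1))"

text \<open>On the spine this is the distance to the root \<open>Spine m\<close>. On a branch it is
  merely a value above all spine ranks that grows outwards, wherever the branch is attached.\<close>

definition A_depth :: "nat \<Rightarrow> bvertex \<Rightarrow> nat" where
  "A_depth m x = (case x of Spine i \<Rightarrow> m - i | Branch i j \<Rightarrow> m + j)"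

lemma A_parent_simps [simp]:
  "A_parent a m (Spine i) = (if i < m then Spine (Suc i) else Spine i)"
  "A_parent a m (Branch i j) = (if j \<le> 1 then (if i \<le> a then Spine 1 else Spine m) else Branch i (j - 1))"
  by (simp_all add: A_parent_def)

lemma A_depth_simps [simp]:
  "A_depth m (Spine i) = m - i" "A_depth m (Branch i j) = m + j"
  by (simp_all add: A_depth_def)

lemma bvertex_image_iff:
  "Spine i \<in> Spine ` X \<longleftrightarrow> i \<in> X"
  "Spine i \<notin> Branch k ` X"
  "Spine i \<notin> (\<lambda>(k, j). Branch k j) ` (X \<times> Y)"
  "Branch k j \<notin> Spine ` X"
  "Branch k j \<in> Branch l ` X \<longleftrightarrow> k = l \<and> j \<in> X"
  "Branch k j \<in> (\<lambda>(k, j). Branch k j) ` (X \<times> Y) \<longleftrightarrow> k \<in> X \<and> j \<in> Y"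
  by auto

text \<open>The spine length \<open>m\<close> is a parameter tied to \<open>n\<close> by an
  addition, which keeps the truncated subtraction of \<open>A_graph\<close> out of the
  computations.\<close>

locale A_tree =
  fixes r n a b m :: nat
  assumes r_pos: "1 \<le> r" and m_pos: "1 \<le> m" and n_eq: "n = m + (a + b) * r"
begin

abbreviation "A \<equiv> A_graph r n a b"

lemma verts_eq: "verts A = Spine ` {1..m} \<union> (\<lambda>(i, j). Branch i j) ` ({1..a + b} \<times> {1..r})"
  by (simp add: verts_A_graph n_eq)

lemma Spine_in: "Spine i \<in> verts A \<longleftrightarrow> 1 \<le> i \<and> i \<le> m"
  and Branch_in: "Branch i j \<in> verts A \<longleftrightarrow> 1 \<le> i \<and> i \<le> a + b \<and> 1 \<le> j \<and> j \<le> r"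
  unfolding verts_eq by auto

lemma edges_A:
  "edges A = {{v, A_parent a m v} | v. v \<in> verts A \<and> v \<noteq> Spine m}"
proof (intro equalityI subsetI)
  fix e
  assume "e \<in> edges A"
  then consider i where "1 \<le> i" "Suc i \<le> m" "e = {Spine i, Spine (Suc i)}"
    | i j where "i \<in> {1..a + b}" "1 \<le> j" "Suc j \<le> r" "e = {Branch i j, Branch i (Suc j)}"
    | i where "i \<in> {1..a}" "e = {Spine 1, Branch i 1}"
    | i where "i \<in> {a + 1..a + b}" "e = {Spine m, Branch i 1}"
    unfolding A_graph_def Let_def by (auto simp: n_eq)
  then have "\<exists>v. v \<in> verts A \<and> v \<noteq> Spine m \<and> e = {v, A_parent a m v}"
  proof cases
    case 1
    then show ?thesis by (intro exI[of _ "Spine i"]) (simp add: Spine_in)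
  next
    case 2
    then show ?thesis by (intro exI[of _ "Branch i (Suc j)"]) (auto simp: Branch_in)
  next
    case 3
    then show ?thesis using r_pos by (intro exI[of _ "Branch i 1"]) (auto simp: Branch_in)
  next
    case 4
    then show ?thesis using r_pos by (intro exI[of _ "Branch i 1"]) (auto simp: Branch_in)
  qed
  then show "e \<in> {{v, A_parent a m v} | v. v \<in> verts A \<and> v \<noteq> Spine m}" by blast
next
  fix e
  assume "e \<in> {{v, A_parent a m v} | v. v \<in> verts A \<and> v \<noteq> Spine m}"
  then obtain v where v: "v \<in> verts A" "v \<noteq> Spine m" "e = {v, A_parent a m v}" by blast
  show "e \<in> edges A"
  proof (cases v)
    case (Spine i)
    then have "1 \<le> i \<and> Suc i \<le> m \<and> e = {Spine i, Spine (Suc i)}" using v Spine_in[of i] by auto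
    then show ?thesis unfolding A_graph_def Let_def by (auto simp: n_eq)
  next
    case (Branch i j)
    then have ij: "1 \<le> i" "i \<le> a + b" "1 \<le> j" "j \<le> r" using v Branch_in[of i j] by auto
    show ?thesis
    proof (cases "j = 1")
      case True
      then have "e = {if i \<le> a then Spine 1 else Spine m, Branch i 1}"
        using v(3) Branch by (simp add: insert_commute)
      then show ?thesis using ij unfolding A_graph_def Let_def by (cases "i \<le> a") (auto simp: n_eq)
    next
      case False
      then have "1 \<le> j - 1" "Suc (j - 1) \<le> r" "e = {Branch i (j - 1), Branch i (Suc (j - 1))}"
        using v(3) Branch ij by (auto simp: insert_commute)
      then have "e \<in> {{Branch i j, Branch i (Suc j)} | i j. i \<in> {1..a + b} \<and> 1 \<le> j \<and> Suc j \<le> r}"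
        using ij(1,2) by fastforce
      then show ?thesis unfolding A_graph_def Let_def by simp
    qed
  qed
qed

sublocale rooted_tree A "Spine m" "A_parent a m" "A_depth m"
proof
  show "finite (verts A)" unfolding verts_eq by simp
  show "Spine m \<in> verts A" using m_pos by (simp add: Spine_in)
  fix v
  assume "v \<in> verts A" "v \<noteq> Spine m"
  then show "A_parent a m v \<in> verts A \<and> A_depth m (A_parent a m v) < A_depth m v"
    using m_pos by (cases v) (auto simp: Spine_in Branch_in)
qed (use edges_A in auto)

definition tips :: "bvertex set" where
  "tips = (\<lambda>i. Branch i r) ` {1..a + b}"

lemma card_tips: "card tips = a + b"
  unfolding tips_def by (subst card_image) (auto simp: inj_on_def)

lemma funpow_Branch: "k < r \<Longrightarrow> (A_parent a m ^^ k) (Branch i r) = Branch i (r - k)"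
  by (induction k) auto

lemma D_Branch:
  assumes "1 \<le> i" "i \<le> a + b" "1 \<le> j" "j \<le> r"
  shows "D (Branch i j) = Branch i ` {j..r}"
proof (rule D_eqI)
  fix w
  assume "w \<in> verts A" "w \<noteq> Spine m" "w \<noteq> Branch i j"
  then show "A_parent a m w \<in> Branch i ` {j..r} \<longleftrightarrow> w \<in> Branch i ` {j..r}"
    using assms by (cases w) (auto simp: Branch_in bvertex_image_iff)
qed (use assms in \<open>auto simp: Branch_in\<close>)

lemma D_Spine:
  assumes "1 \<le> i" "i < m"
  shows "D (Spine i) = Spine ` {1..i} \<union> (\<lambda>(k, j). Branch k j) ` ({1..a} \<times> {1..r})"
proof (rule D_eqI)
  fix w
  assume "w \<in> verts A" "w \<noteq> Spine m" "w \<noteq> Spine i"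
  then show "A_parent a m w \<in> Spine ` {1..i} \<union> (\<lambda>(k, j). Branch k j) ` ({1..a} \<times> {1..r}) \<longleftrightarrow>
    w \<in> Spine ` {1..i} \<union> (\<lambda>(k, j). Branch k j) ` ({1..a} \<times> {1..r})"
    using assms by (cases w) (auto simp: Spine_in Branch_in bvertex_image_iff)
qed (use assms in \<open>auto simp: Spine_in Branch_in\<close>)

lemma card_D_Spine:
  assumes "1 \<le> i" "i < m"
  shows "card (D (Spine i)) = i + a * r"
proof -
  have "card (D (Spine i)) = card (Spine ` {1..i}) + card ((\<lambda>(k, j). Branch k j) ` ({1..a} \<times> {1..r}))"
    unfolding D_Spine[OF assms] by (rule card_Un_disjoint) auto
  then show ?thesis by (simp add: card_image inj_on_def card_cartesian_product)
qed

sublocale rooted_tree_with_paths A "Spine m" "A_parent a m" "A_depth m" tips r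
proof
  show "tips \<subseteq> verts A" using r_pos by (auto simp: tips_def Branch_in)
  fix l k
  assume "l \<in> tips" "k < r"
  then obtain i where i: "1 \<le> i" "i \<le> a + b" "l = Branch i r" by (auto simp: tips_def)
  then show "(A_parent a m ^^ k) l \<noteq> Spine m" using funpow_Branch[OF \<open>k < r\<close>] by simp
  have "D ((A_parent a m ^^ k) l) = Branch i ` {r - k..r}"
    using funpow_Branch[OF \<open>k < r\<close>] i \<open>k < r\<close> D_Branch[of i "r - k"] by simp
  then show "card (D ((A_parent a m ^^ k) l)) = Suc k"
    using \<open>k < r\<close> by (simp add: card_image inj_on_def)
qed (rule r_pos)

lemma W_eq: "W = Spine ` {1..m}"
proof -
  have "Hang = (\<lambda>(i, j). Branch i j) ` ({1..a + b} \<times> {1..r})"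
  proof (intro equalityI subsetI)
    fix x
    assume "x \<in> Hang"
    then obtain l k where "l \<in> tips" "k < r" "x = (A_parent a m ^^ k) l" by (rule HangE)
    then show "x \<in> (\<lambda>(i, j). Branch i j) ` ({1..a + b} \<times> {1..r})"
      by (auto simp: tips_def funpow_Branch bvertex_image_iff)
  next
    fix x
    assume "x \<in> (\<lambda>(i, j). Branch i j) ` ({1..a + b} \<times> {1..r})"
    then obtain i j where ij: "i \<in> {1..a + b}" "1 \<le> j" "j \<le> r" "x = Branch i j" by auto
    then have "x = (A_parent a m ^^ (r - j)) (Branch i r)" using funpow_Branch[of "r - j" i] by simp
    then show "x \<in> Hang" using HangI[of "Branch i r" "r - j"] ij by (auto simp: tips_def)
  qed
  then show ?thesis unfolding W_def verts_eq by auto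
qed

lemma card_verts_A: "card (verts A) = n"
  using order_A_graph[of a b r n] by (simp add: order_def n_eq)

lemma mostar_A: "mostar_index A = (\<Sum>i\<in>{1..<m}. \<bar>int n - 2 * int (i + a * r)\<bar>)
    + int (a + b) * (\<Sum>i<r. \<bar>int n - 2 * int (Suc i)\<bar>)"
proof -
  have "W - {Spine m} = Spine ` {1..<m}" unfolding W_eq by auto
  then have "(\<Sum>v\<in>W - {Spine m}. \<bar>int n - 2 * int (card (D v))\<bar>)
      = (\<Sum>i\<in>{1..<m}. \<bar>int n - 2 * int (card (D (Spine i)))\<bar>)"
    by (simp add: sum.reindex inj_on_def)
  also have "\<dots> = (\<Sum>i\<in>{1..<m}. \<bar>int n - 2 * int (i + a * r)\<bar>)"
    by (intro sum.cong refl) (simp add: card_D_Spine)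
  finally show ?thesis using sum_paths_and_rest by (simp only: card_verts_A card_tips)
qed

end

section \<open>Comparison of the layer counts with those of the balanced tree\<close>

lemma sum_abs_eq:
  fixes d :: "'a \<Rightarrow> nat"
  assumes "\<And>x. x \<in> X \<Longrightarrow> d x \<le> N"
  shows "(\<Sum>x\<in>X. \<bar>int N - 2 * int (d x)\<bar>) = int (card X) * int N - 2 * int (\<Sum>x\<in>X. min (d x) (N - d x))"
proof -
  have "(\<Sum>x\<in>X. \<bar>int N - 2 * int (d x)\<bar>) = (\<Sum>x\<in>X. int N - 2 * int (min (d x) (N - d x)))"
  proof (rule sum.cong[OF refl])
    fix x
    assume "x \<in> X"
    from assms[OF this] show "\<bar>int N - 2 * int (d x)\<bar> = int N - 2 * int (min (d x) (N - d x))"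
      by (auto simp: min_def of_nat_diff)
  qed
  then show ?thesis by (simp add: sum_subtractf sum_distrib_left)
qed

text \<open>Here \<open>x\<close> and \<open>y\<close> stand for \<open>a * r\<close> and \<open>b * r\<close>.\<close>

lemma card_thick_spine_edges:
  fixes m x y t :: nat
  assumes "1 \<le> t"
  shows "card {i \<in> {1..<m}. t \<le> min (i + x) (m + x + y - (i + x))} =
    Suc (min (m - 1) (m + y - t)) - max 1 (t - x)"
proof -
  have "{i \<in> {1..<m}. t \<le> min (i + x) (m + x + y - (i + x))} = {max 1 (t - x)..min (m - 1) (m + y - t)}"
    using assms by auto
  then show ?thesis by simp
qed

text \<open>The counted indices form an interval. The combinations of its possible ends give the
  lengths \<open>m - 1\<close>, \<open>m + y - t\<close>, \<open>m + x - t\<close> and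
  \<open>m + x + y + 1 - 2 * t\<close>; the third is at least the second because
  \<open>y \<le> x\<close>, and the remaining three are the given bounds.\<close>

lemma le_card_thick_spine_edges:
  fixes k m x y t :: nat
  assumes "k + 2 * t \<le> m + x + y + 1" "k + t \<le> m + y" "k \<le> m - 1" "1 \<le> m" "y \<le> x" "1 \<le> t"
  shows "k \<le> card {i \<in> {1..<m}. t \<le> min (i + x) (m + x + y - (i + x))}"
proof -
  have "k + max 1 (t - x) \<le> Suc (m - 1)" "k + max 1 (t - x) \<le> Suc (m + y - t)"
    using assms by (cases "t - x \<le> 1"; simp add: max_def)+
  then have "k + max 1 (t - x) \<le> Suc (min (m - 1) (m + y - t))" by (simp only: min_Suc_Suc[symmetric] min.bounded_iff)
  then show ?thesis unfolding card_thick_spine_edges[OF assms(6)] by (rule add_le_imp_le_diff)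
qed

context rooted_tree_with_paths
begin

lemma card_W_pos: "1 \<le> card W"
  using card_mono[OF finite_W, of "{c}"] by simp

text \<open>Both trees have \<open>m - 1\<close> core edges and the same contribution of path edges,
  so a small Mostar index means a large sum of smaller sides. The bounds on thick edges give
  domination at every threshold, and the layer argument then yields equality. The right-hand side is
  the count in the balanced tree.\<close>

lemma thick_edge_counts_eq:
  assumes L: "card L = a + b" "b \<le> a" "a \<le> b + 1"
    and n: "card (verts G) = n" and le: "mostar_index G \<le> mostar_index (A_graph r n a b)"
    and t: "1 \<le> t"
  shows "card {v \<in> W - {c}. t \<le> min (card (D v)) (n - card (D v))} =
    Suc (min (card W - 1) (card W + b * r - t)) - max 1 (t - a * r)"
proof -
  define m where "m = card W"
  have "1 \<le> m" unfolding m_def by (rule card_W_pos)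
  moreover have nm: "n = m + (a + b) * r" using card_verts n L(1) by (simp add: m_def mult.commute)
  ultimately interpret A: A_tree r n a b m using r_pos by unfold_locales
  let ?f = "\<lambda>v. min (card (D v)) (n - card (D v))"
  let ?g = "\<lambda>i. min (i + a * r) (m + a * r + b * r - (i + a * r))"
  have nm': "n = m + a * r + b * r" using nm by (simp add: add_mult_distrib)
  have cardX: "card (W - {c}) = m - 1" by (simp add: m_def)
  have "mostar_index G = int (m - 1) * int n - 2 * int (\<Sum>v\<in>W - {c}. ?f v)
      + int (a + b) * (\<Sum>i<r. \<bar>int n - 2 * int (Suc i)\<bar>)"
    using sum_paths_and_rest sum_abs_eq[of "W - {c}" "\<lambda>v. card (D v)" n] card_D_le
    by (simp only: n L cardX)
  moreover have "mostar_index (A_graph r n a b) = int (m - 1) * int n - 2 * int (\<Sum>i\<in>{1..<m}. ?g i)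
      + int (a + b) * (\<Sum>i<r. \<bar>int n - 2 * int (Suc i)\<bar>)"
    using A.mostar_A sum_abs_eq[of "{1..<m}" "\<lambda>i. i + a * r" n] nm' by simp
  ultimately have sums: "sum ?g {1..<m} \<le> sum ?f (W - {c})" using le by linarith
  have count_le: "card {v \<in> W - {c}. s \<le> ?f v} \<le> card {i \<in> {1..<m}. s \<le> ?g i}" if "1 \<le> s" for s
  proof (cases "{v \<in> W - {c}. s \<le> ?f v} = {}")
    case True
    then show ?thesis by (simp only: card.empty le0)
  next
    case False
    have *: "s \<le> card (D v) \<and> s + card (D v) \<le> card (verts G)" if "v \<in> {v \<in> W - {c}. s \<le> ?f v}" for v
      using that \<open>1 \<le> s\<close> n by auto
    have "card L \<le> 2 * b + 1" using L by simp
    note bounds = card_thick_edges_le[OF _ False * this]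
    have "card {v \<in> W - {c}. s \<le> ?f v} + 2 * s \<le> n + 1"
      "card {v \<in> W - {c}. s \<le> ?f v} + s \<le> m + r * b"
      using bounds n by (auto simp: m_def)
    moreover have "card {v \<in> W - {c}. s \<le> ?f v} \<le> m - 1"
      unfolding cardX[symmetric] by (rule card_mono) auto
    moreover have "b * r \<le> a * r" using L(2) by simp
    ultimately show ?thesis
      using \<open>1 \<le> m\<close> \<open>1 \<le> s\<close> unfolding nm' by (intro le_card_thick_spine_edges) (simp_all add: mult.commute)
  qed
  have "card {v \<in> W - {c}. t \<le> ?f v} = card {i \<in> {1..<m}. t \<le> ?g i}"
    using layers_eq_if_sum_ge[OF _ _ count_le sums t] by simp
  then show ?thesis unfolding card_thick_spine_edges[OF t] by (simp add: m_def)
qed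

lemma mostar_le_imp_chain:
  assumes L: "card L = a + b" "b \<le> a" "a \<le> b + 1" "1 \<le> b"
    and end_root: "\<And>x y. x \<in> W - {c} \<Longrightarrow> y \<in> W - {c} \<Longrightarrow> p x = c \<Longrightarrow> p y = c \<Longrightarrow> x = y"
    and n: "card (verts G) = n" and le: "mostar_index G \<le> mostar_index (A_graph r n a b)"
  shows "\<exists>v L1 L2. v \<in> W \<and> (\<forall>w\<in>W. v \<in> D w) \<and> L1 \<union> L2 = L \<and> L1 \<inter> L2 = {} \<and>
    (\<forall>l\<in>L1. (p ^^ r) l = c) \<and> (\<forall>l\<in>L2. (p ^^ r) l = v) \<and>
    (card L1 = a \<and> card L2 = b \<or> card L1 = b \<and> card L2 = a)"
proof (rule core_is_chain[OF L end_root])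
  let ?f = "\<lambda>v. min (card (D v)) (n - card (D v))"
  note counts = thick_edge_counts_eq[OF L(1-3) n le]
  have cardX: "card (W - {c}) = card W - 1" by simp
  have ab: "b * r \<le> a * r" using L(2) by simp
  have "card {v \<in> W - {c}. b * r + 1 \<le> ?f v} = card (W - {c})"
    using counts[of "b * r + 1"] card_W_pos ab unfolding cardX by simp
  then have all: "{v \<in> W - {c}. b * r + 1 \<le> ?f v} = W - {c}" by (intro card_subset_eq) auto
  show size: "r * b + 1 \<le> card (D v) \<and> r * b + 1 + card (D v) \<le> card (verts G)" if "v \<in> W - {c}" for v
  proof -
    have "b * r + 1 \<le> ?f v" using all that by blast
    then show ?thesis unfolding min.bounded_iff using n mult.commute[of r b] by linarith
  qed
  fix x y
  assume a: "a = b + 1" and xy: "x \<in> W - {c}" "y \<in> W - {c}"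
    and thin: "card (D x) = r * b + 1 \<or> r * b + 1 + card (D x) = card (verts G)"
     "card (D y) = r * b + 1 \<or> r * b + 1 + card (D y) = card (verts G)"
  let ?T = "{v \<in> W - {c}. b * r + 2 \<le> ?f v}"
  \<comment> \<open>This keeps the lower end \<open>max 1 (t - a * r)\<close> of the index interval
    at 1 for \<open>t = b * r + 2\<close>, so raising the threshold from \<open>b * r + 1\<close>
    costs at most one edge.\<close>
  have "b * r + 1 \<le> a * r" using a r_pos by simp
  then have "card (W - {c}) \<le> card ?T + 1"
    using counts[of "b * r + 2"] unfolding cardX by simp
  then have *: "card (W - {c} - ?T) \<le> Suc 0" by (subst card_Diff_subset) auto
  define S where "S = W - {c} - ?T"
  have "finite S" "card S \<le> Suc 0" using * by (simp_all only: S_def finite_Diff finite_W)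
  then have "\<forall>x\<in>S. \<forall>y\<in>S. x = y" by (simp only: card_le_Suc0_iff_eq)
  moreover have "x \<in> S" "y \<in> S"
    using xy thin n by (auto simp: S_def mult.commute)
  ultimately show "x = y" by blast
qed

end

section \<open>Symmetry, degrees and pendent paths of the extremal trees\<close>

context A_tree
begin

text \<open>This tree is rooted at \<open>Spine m\<close>, where the \<open>b\<close> branches are
  attached, while \<open>chain_iso_A_graph\<close> sends the root to \<open>Spine 1\<close>;
  applying it to the tree itself therefore exchanges the two numbers.\<close>

lemma A_graph_swap: "A \<cong>\<^sub>g A_graph r n b a"
proof -
  interpret B: A_tree r n b a m
    using r_pos m_pos n_eq by unfold_locales (simp_all add: add.commute)
  define f where "f i = Branch i r" for i
  have r: "r = Suc (r - 1)" using r_pos by simp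
  have top: "(A_parent a m ^^ r) (f i) = (if i \<le> a then Spine 1 else Spine m)" for i
  proof -
    have "(A_parent a m ^^ r) (f i) = A_parent a m ((A_parent a m ^^ (r - 1)) (f i))"
      by (subst r) simp
    also have "(A_parent a m ^^ (r - 1)) (f i) = Branch i 1"
      using funpow_Branch[of "r - 1" i] r_pos by (simp add: f_def)
    finally show ?thesis by simp
  qed
  have card_f: "card (f ` X) = card X" for X
    by (rule card_image) (auto simp: f_def inj_on_def)
  show ?thesis
  proof (rule chain_iso_A_graph)
    show "Spine 1 \<in> W" using m_pos by (auto simp: W_eq)
    show "Spine 1 \<in> D w" if w: "w \<in> W" for w
    proof (cases "w = Spine m")
      case True
      then show ?thesis using m_pos by (simp add: in_D_root Spine_in)
    next
      case False
      moreover obtain i where i: "w = Spine i" "1 \<le> i" "i \<le> m" using w by (auto simp: W_eq)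
      ultimately have "i < m" by (cases "i = m") auto
      then show ?thesis using D_Spine[of i] i by auto
    qed
    have "{1..a + b} = {a + 1..a + b} \<union> {1..a}" by auto
    then show "f ` {a + 1..a + b} \<union> f ` {1..a} = tips"
      unfolding tips_def f_def by (simp only: image_Un)
    show "f ` {a + 1..a + b} \<inter> f ` {1..a} = {}" by (auto simp: f_def)
    show "card (f ` {a + 1..a + b}) = b" "card (f ` {1..a}) = a" by (simp_all add: card_f)
    show "(A_parent a m ^^ r) l = Spine m" if "l \<in> f ` {a + 1..a + b}" for l
      using that top by auto
    show "(A_parent a m ^^ r) l = Spine 1" if "l \<in> f ` {1..a}" for l
      using that top by auto
    show "card (verts A) = n" by (rule card_verts_A)
    show "simple_graph (A_graph r n b a)" by (rule B.simple)
  qed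
qed

lemma children_Branch:
  assumes "1 \<le> i" "i \<le> a + b" "1 \<le> j" "j \<le> r"
  shows "children (Branch i j) = (if j < r then {Branch i (Suc j)} else {})"
proof -
  have "w \<in> children (Branch i j) \<longleftrightarrow> j < r \<and> w = Branch i (Suc j)" for w
    using assms by (cases w) (auto simp: children_def Spine_in Branch_in)
  then show ?thesis by auto
qed

lemma degree_Branch:
  assumes "1 \<le> i" "i \<le> a + b" "1 \<le> j" "j \<le> r"
  shows "degree A (Branch i j) = (if j < r then 2 else 1)"
  using degree_eq[of "Branch i j"] assms by (simp add: Branch_in children_Branch)

lemma children_Spine:
  assumes "1 \<le> i" "i \<le> m"
  shows "children (Spine i) = (if 1 < i then {Spine (i - 1)} else {}) \<union>
    (\<lambda>k. Branch k 1) ` ((if i = 1 then {1..a} else {}) \<union> (if i = m then {a + 1..a + b} else {}))"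
proof -
  have "w \<in> children (Spine i) \<longleftrightarrow> w \<in> (if 1 < i then {Spine (i - 1)} else {}) \<union>
    (\<lambda>k. Branch k 1) ` ((if i = 1 then {1..a} else {}) \<union> (if i = m then {a + 1..a + b} else {}))" for w
    using assms r_pos by (cases w) (auto simp: children_def Spine_in Branch_in)
  then show ?thesis by blast
qed

lemma degree_Spine:
  assumes "1 \<le> i" "i \<le> m"
  shows "degree A (Spine i) =
    (if 1 < i then 1 else a) + (if i < m then 1 else b)"
proof -
  have card_Branch: "card ((\<lambda>k. Branch k (Suc 0)) ` X) = card X" for X
    by (simp add: card_image inj_on_def)
  have "card (children (Spine i)) = (if 1 < i then 1 else a) + (if i < m then 0 else b)"
  proof (cases "1 < i")
    case True
    then have "children (Spine i) = insert (Spine (i - 1)) ((\<lambda>k. Branch k 1) ` (if i = m then {a + 1..a + b} else {}))"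
      using children_Spine[OF assms] by simp
    then show ?thesis using True assms by (auto simp: card_insert_if card_Branch)
  next
    case False
    then have "i = 1" using assms by simp
    then have "children (Spine i) = (\<lambda>k. Branch k 1) ` ({1..a} \<union> (if i = m then {a + 1..a + b} else {}))"
      using children_Spine[OF assms] by simp
    then have "card (children (Spine i)) = card ({1..a} \<union> (if i = m then {a + 1..a + b} else {}))"
      by (simp add: card_Branch)
    also have "\<dots> = a + (if i = m then b else 0)"
      by (subst card_Un_disjoint) auto
    finally show ?thesis using False assms by auto
  qed
  then show ?thesis using degree_eq[of "Spine i"] assms by (auto simp: Spine_in)
qed

lemma leaf_is_tip:
  assumes "1 \<le> a" "1 \<le> b" "v \<in> verts A" "degree A v = 1"
  shows "v \<in> tips"
proof (cases v)
  case (Spine i)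
  then show ?thesis using assms degree_Spine[of i] by (auto simp: Spine_in split: if_splits)
next
  case (Branch i j)
  then have "1 \<le> i" "i \<le> a + b" "1 \<le> j" "j \<le> r" using assms(3) by (auto simp: Branch_in)
  moreover from this have "j = r" using degree_Branch[of i j] assms(4) Branch by (cases "j < r") auto
  ultimately show ?thesis using Branch by (auto simp: tips_def)
qed

lemma hd_pendent_in_tips:
  assumes "1 \<le> a" "1 \<le> b" "us \<in> pendent_paths A s"
  shows "hd us \<in> tips"
  unfolding pendent_pathsD(5)[OF assms(3)]
  by (rule leaf_is_tip[OF assms(1,2) pendent_pathsD(11,6)[OF assms(3)]]) simp

lemma card_pendent_hd: "card (pendent_paths A s) = card (hd ` pendent_paths A s)"
  by (simp add: card_image inj_on_hd_pendent_paths)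

text \<open>With branches at both ends no spine vertex is a leaf, so pendent paths start at tips;
  conversely, following parents from a tip for \<open>r\<close> steps arrives at a spine vertex of
  degree at least 2.\<close>

lemma card_pendent_paths_A:
  assumes "1 \<le> a" "1 \<le> b"
  shows "card (pendent_paths A r) = a + b"
proof -
  have "hd ` pendent_paths A r = tips"
  proof (intro equalityI subsetI)
    fix l
    assume l: "l \<in> tips"
    then obtain i where i: "1 \<le> i" "i \<le> a + b" "l = Branch i r" by (auto simp: tips_def)
    let ?us = "map (\<lambda>k. (A_parent a m ^^ k) l) [0..<Suc r]"
    have "(A_parent a m ^^ r) l \<in> W" by (rule path_top_in_W[OF l])
    then obtain k where "1 \<le> k" "k \<le> m" "(A_parent a m ^^ r) l = Spine k" by (auto simp: W_eq)
    then have "2 \<le> degree A ((A_parent a m ^^ r) l)" using degree_Spine[of k] assms by auto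
    moreover have "degree A ((A_parent a m ^^ k) l) = 2" if "1 \<le> k" "k < r" for k
      using funpow_Branch[OF that(2), of i] degree_Branch[of i "r - k"] i that by simp
    ultimately have "?us \<in> pendent_paths A r"
      using l i r_pos path_nonroot[OF l] degree_Branch[of i r]
      by (intro ascending_pendent_path) (auto simp: Branch_in)
    moreover have "hd ?us = l" by (simp add: hd_map del: upt_Suc)
    ultimately show "l \<in> hd ` pendent_paths A r" by force
  qed (use hd_pendent_in_tips[OF assms] in auto)
  then show ?thesis by (simp add: card_pendent_hd card_tips)
qed

end

text \<open>The one path climbs from \<open>Branch 1 1\<close> along the spine. The other two leaves
  are adjacent to \<open>Spine (n - 3)\<close>, whose degree is 3, so it cannot be an inner vertex
  of a pendent path of length at least 2.\<close>

lemma card_pendent_paths_A112: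
  assumes "2 \<le> s" "s + 3 \<le> n"
  shows "card (pendent_paths (A_graph 1 n 1 2) s) = 1"
proof -
  interpret A: A_tree 1 n 1 2 "n - 3" using assms by unfold_locales auto
  have "hd ` pendent_paths A.A s = {Branch 1 1}"
  proof (intro equalityI subsetI)
    fix l
    assume "l \<in> hd ` pendent_paths A.A s"
    then obtain us where us: "us \<in> pendent_paths A.A s" "l = hd us" by blast
    note u = pendent_pathsD[OF us(1)]
    have "hd us \<in> A.tips" using A.hd_pendent_in_tips us(1) by simp
    then obtain i where i: "1 \<le> i" "i \<le> 3" "us ! 0 = Branch i 1"
      using u(5) unfolding A.tips_def by auto
    have "i = 1"
    proof (rule ccontr)
      assume "i \<noteq> 1"
      have "A.children (us ! 0) = {}" using i A.children_Branch[of i 1] by simp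
      moreover have "{us ! 0, us ! 1} \<in> edges A.A" using u(9)[of 0] assms(1) by simp
      then have "us ! 1 \<in> A.children (us ! 0) \<or> us ! 1 = A_parent 1 (n - 3) (us ! 0)"
        unfolding A.edge_iff A.children_def mem_Collect_eq by metis
      ultimately have "us ! 1 = Spine (n - 3)" using i \<open>i \<noteq> 1\<close> by simp
      moreover have "degree A.A (us ! 1) = 2" using u(8)[of 1] assms(1) by simp
      moreover have "1 \<le> n - 3" "n - 3 > 1" using assms by simp_all
      ultimately show False using A.degree_Spine[of "n - 3"] by simp
    qed
    then show "l \<in> {Branch 1 1}" using i u(5) us(2) by simp
  next
    fix l
    assume l: "l \<in> {Branch 1 1}"
    let ?p = "A_parent 1 (n - 3)"
    have up: "(?p ^^ Suc k) l = Spine (Suc k)" if "k < n - 3" for k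
      using that by (induction k) (use l in auto)
    have up': "(?p ^^ k) l = Spine k" if "1 \<le> k" "k \<le> n - 3" for k
      using up[of "k - 1"] that by simp
    let ?us = "map (\<lambda>k. (?p ^^ k) l) [0..<Suc s]"
    have "(?p ^^ k) l \<noteq> Spine (n - 3)" if "k < s" for k
      using up'[of k] that assms l by (cases "k = 0") auto
    then have "?us \<in> pendent_paths A.A s"
      using l assms up' A.degree_Branch[of 1 1] A.degree_Spine A.Branch_in[of 1 1]
      by (intro A.ascending_pendent_path) auto
    moreover have "hd ?us = l" by (simp add: hd_map del: upt_Suc)
    ultimately show "l \<in> hd ` pendent_paths A.A s" by force
  qed
  then show ?thesis unfolding A.card_pendent_hd by simp
qed

section \<open>Trees with two leaves and trees with a unique pendent path\<close>

lemma (in rooted_tree) pendent_path_if_two_leaves: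
  assumes leaves: "{x \<in> verts G. degree G x = 1} = {c, v}" and "c \<noteq> v"
    and s: "1 \<le> s" "s + 2 \<le> card (verts G)"
  shows "\<exists>us\<in>pendent_paths G s. hd us = v"
proof -
  have v: "v \<in> verts G" "degree G v = 1" using leaves by auto
  \<comment> \<open>A lowest vertex of \<open>D x\<close> is childless, hence a leaf different from
    the root, hence \<open>v\<close>. So every vertex is an ancestor of \<open>v\<close>, and the
    tree is a chain.\<close>
  have vD: "v \<in> D x" if x: "x \<in> verts G" for x
  proof -
    have fD: "finite (h ` D x)" "h ` D x \<noteq> {}" using D_self[OF x] by (simp, blast)
    then have "Max (h ` D x) \<in> h ` D x" by (rule Max_in)
    then obtain w where w: "w \<in> D x" "h w = Max (h ` D x)" by auto
    have max: "h y \<le> h w" if "y \<in> D x" for y using fD w(2) that by simp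
    have wV: "w \<in> verts G" using w(1) D_subset by blast
    have ch: "children w = {}"
    proof (rule ccontr)
      assume "children w \<noteq> {}"
      then obtain y where y: "y \<in> verts G" "y \<noteq> c" "p y = w" by (auto simp: children_def)
      then have "y \<in> D x" using D_trans[OF w(1)] D_funpow[of y 1] by simp
      then show False using max parent[OF y(1,2)] y(3) by fastforce
    qed
    have "w \<noteq> c"
    proof
      assume "w = c"
      then have "degree G c = 0" using degree_eq[of c] ch by simp
      moreover have "degree G c = 1" using leaves by blast
      ultimately show False by simp
    qed
    then have "degree G w = 1" using degree_eq[OF wV] ch by simp
    then have "w = v" using leaves wV \<open>w \<noteq> c\<close> by blast
    then show ?thesis using w(1) by simp
  qed
  obtain N where N: "(p ^^ N) v = c" and below_N: "\<And>i. i < N \<Longrightarrow> (p ^^ i) v \<noteq> c"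
    and after_N: "\<And>i. N \<le> i \<Longrightarrow> (p ^^ i) v = c"
    using ex_root_distance[OF v(1)] by blast
  have verts_sub: "verts G \<subseteq> (\<lambda>i. (p ^^ i) v) ` {..N}"
  proof
    fix w
    assume "w \<in> verts G"
    then obtain i where "(p ^^ i) v = w" using vD by (auto simp: D_def)
    then have "w = (p ^^ (if i \<le> N then i else N)) v" using after_N[of i] N by simp
    then show "w \<in> (\<lambda>i. (p ^^ i) v) ` {..N}" by (rule image_eqI) simp
  qed
  then have "card (verts G) \<le> Suc N"
    using surj_card_le[OF _ verts_sub] by simp
  \<comment> \<open>The path has to stop strictly below the root, which is a leaf and could not be
    its final vertex.\<close>
  then have sN: "s < N" using s by simp
  have "degree G ((p ^^ i) v) = 2" if i: "1 \<le> i" "i \<le> s" for i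
  proof -
    have iV: "(p ^^ i) v \<in> verts G" "(p ^^ i) v \<noteq> c" using v below_N[of i] i sN by auto
    have "children ((p ^^ i) v) = {(p ^^ (i - 1)) v}"
    proof (intro equalityI subsetI)
      fix w
      assume "w \<in> children ((p ^^ i) v)"
      then have w: "w \<in> verts G" "w \<noteq> c" "p w = (p ^^ i) v" by (auto simp: children_def)
      then obtain j where j: "j \<le> N" "w = (p ^^ j) v" using verts_sub by auto
      then have "j < N" using w(2) N by (cases "j = N") auto
      then have eq: "(p ^^ Suc j) v = (p ^^ i) v" "Suc j \<le> N" "i \<le> N" using w(3) j(2) i sN by auto
      then have "Suc j = i"
        using funpow_inj[OF v(1) _ _ below_N eq(1)] funpow_inj[OF v(1) _ _ below_N eq(1)[symmetric]]
          nat_le_linear[of "Suc j" i] by metis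
      then show "w \<in> {(p ^^ (i - 1)) v}" using j(2) by auto
    next
      fix w
      assume "w \<in> {(p ^^ (i - 1)) v}"
      moreover have "p ((p ^^ (i - 1)) v) = (p ^^ i) v" using i(1) by (cases i) auto
      ultimately show "w \<in> children ((p ^^ i) v)"
        using below_N[of "i - 1"] i sN v(1) by (auto simp: children_def)
    qed
    then show ?thesis using degree_eq[OF iV(1)] iV(2) by simp
  qed
  then have "map (\<lambda>i. (p ^^ i) v) [0..<Suc s] \<in> pendent_paths G s"
    using s(1) v below_N sN by (intro ascending_pendent_path) auto
  moreover have "hd (map (\<lambda>i. (p ^^ i) v) [0..<Suc s]) = v" by (simp add: hd_map del: upt_Suc)
  ultimately show ?thesis by blast
qed

lemma card_pendent_paths_two_leaves:
  assumes "is_tree G" "{x \<in> verts G. degree G x = 1} = {u, v}" "u \<noteq> v"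
    and "1 \<le> s" "s + 2 \<le> card (verts G)"
  shows "card (pendent_paths G s) = 2"
proof -
  have "u \<in> verts G" "v \<in> verts G" using assms(2) by auto
  then obtain p h p' h' where "rooted_tree G u p h" "rooted_tree G v p' h'"
    using rooted_tree_exists[OF assms(1)] by metis
  then obtain us vs where us: "us \<in> pendent_paths G s" "hd us = v"
    and vs: "vs \<in> pendent_paths G s" "hd vs = u"
    using rooted_tree.pendent_path_if_two_leaves[of G u p h v s]
      rooted_tree.pendent_path_if_two_leaves[of G v p' h' u s] assms by (metis insert_commute)
  have "hd ` pendent_paths G s \<subseteq> {u, v}"
  proof
    fix x
    assume "x \<in> hd ` pendent_paths G s"
    then obtain ws where ws: "ws \<in> pendent_paths G s" "x = hd ws" by blast
    then have "x \<in> {x \<in> verts G. degree G x = 1}" using pendent_pathsD[OF ws(1)] by simp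
    then show "x \<in> {u, v}" unfolding assms(2) .
  qed
  then have "hd ` pendent_paths G s = {u, v}" using us vs by force
  then have "card (hd ` pendent_paths G s) = 2" using assms(3) by simp
  then show ?thesis by (simp add: card_image inj_on_hd_pendent_paths)
qed

text \<open>If the neighbour of the leaf had degree 1 as well, the two vertices would form the whole
  tree.\<close>

lemma tree_leaf_pendent_path:
  assumes "is_tree G" "3 \<le> card (verts G)" "x \<in> verts G" "degree G x = 1"
  shows "x \<in> hd ` pendent_paths G 1"
proof -
  have simple: "simple_graph G" and conn: "graph_connected G" using assms(1) by (auto simp: is_tree_def)
  obtain e where "{e \<in> edges G. x \<in> e} = {e}"
    using assms(4) unfolding degree_def by (auto simp: card_1_singleton_iff)
  then have e: "e \<in> edges G" "x \<in> e" by blast+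
  moreover have "card e = 2" using e(1) simple by (auto simp: simple_graph_def)
  ultimately obtain y where "e = {x, y}" by (auto simp: card_2_iff)
  then have xy: "{x, y} \<in> edges G" using e(1) by simp
  then have y: "y \<in> verts G" "x \<noteq> y" using edge_in_verts[OF simple] by blast+
  have yx: "{y, x} \<in> edges G" using xy by (simp add: insert_commute)
  have "degree G y \<noteq> 1"
  proof
    assume y1: "degree G y = 1"
    have "z \<in> {x, y}" if "(x, z) \<in> {(u, v). {u, v} \<in> edges G}\<^sup>*" for z
      using that
    proof (induction rule: rtrancl_induct)
      case (step z w)
      then have "{z, w} \<in> edges G" by simp
      then show ?case
        using step.IH degree_one_edge_unique[OF assms(4) xy] degree_one_edge_unique[OF y1 yx] by blast
    qed simp
    then have "verts G \<subseteq> {x, y}" using conn assms(3) unfolding graph_connected_iff_rtrancl[OF simple] by blast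
    then have "card (verts G) \<le> card {x, y}" by (rule card_mono[rotated]) simp
    also have "\<dots> \<le> 2" by (simp add: card_insert_if)
    finally show False using assms(2) by simp
  qed
  moreover have "degree G y \<noteq> 0"
  proof -
    have "finite (edges G)"
      by (rule finite_subset[of _ "Pow (verts G)"]) (use simple in \<open>auto simp: simple_graph_def\<close>)
    then show ?thesis using yx unfolding degree_def by auto
  qed
  ultimately have "[x, y] \<in> pendent_paths G 1"
    using assms(3,4) xy y by (auto simp: pendent_paths_def graph_path_def graph_walk_def)
  then show ?thesis by force
qed

text \<open>A tree with just two leaves has two pendent paths of length \<open>s\<close>, one from
  each leaf. Uniqueness thus yields a third leaf, and each leaf starts a pendent path of length
  1.\<close>

lemma three_leaves_if_unique_pendent_path:
  assumes "is_tree G" "card (pendent_paths G s) = 1" "s + 2 \<le> card (verts G)"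
  shows "3 \<le> card (pendent_paths G 1)"
proof -
  have fin: "finite (verts G)" using assms(1) by (auto simp: is_tree_def simple_graph_def)
  obtain us where us: "us \<in> pendent_paths G s" using assms(2) by (auto simp: card_1_singleton_iff)
  note u = pendent_pathsD[OF us]
  let ?L = "{x \<in> verts G. degree G x = 1}"
  have n: "3 \<le> card (verts G)" using u(1) assms(3) by simp
  have "verts G \<noteq> {us ! 0}" using n by auto
  then obtain v q where v: "v \<in> verts G" "v \<noteq> us ! 0" "{v, q} \<in> edges G" "\<forall>y. {v, y} \<in> edges G \<longrightarrow> y = q"
    using tree_leaf[OF assms(1) u(11)[of 0]] by auto
  have "{e \<in> edges G. v \<in> e} = {{v, q}}"
  proof -
    have "e = {v, q}" if e: "e \<in> edges G" "v \<in> e" for e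
    proof -
      have "card e = 2" using e assms(1) by (auto simp: is_tree_def simple_graph_def)
      then obtain y where "e = {v, y}" using e(2) by (auto simp: card_2_iff)
      then show ?thesis using v(4) e(1) by blast
    qed
    then show ?thesis using v(3) by blast
  qed
  then have "degree G v = 1" by (simp add: degree_def)
  then have sub: "{us ! 0, v} \<subseteq> ?L" using v(1) u(6) u(11)[of 0] by simp
  have "?L \<noteq> {us ! 0, v}"
    using card_pendent_paths_two_leaves[OF assms(1) _ _ u(1) assms(3), of "us ! 0" v] assms(2) v(2) by auto
  then have "card {us ! 0, v} < card ?L" using sub fin by (intro psubset_card_mono) auto
  then have "3 \<le> card ?L" using v(2) by simp
  also have "\<dots> \<le> card (hd ` pendent_paths G 1)"
    using tree_leaf_pendent_path[OF assms(1) n] finite_pendent_paths[OF fin] by (intro card_mono) auto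
  also have "\<dots> = card (pendent_paths G 1)" by (rule card_image[OF inj_on_hd_pendent_paths])
  finally show ?thesis .
qed

section \<open>From the extremal statement to the three cases\<close>

lemma A111_iso_path_graph:
  assumes "3 \<le> n"
  shows "A_graph 1 n 1 1 \<cong>\<^sub>g path_graph n"
proof -
  interpret A: A_tree 1 n 1 1 "n - 2" using assms by unfold_locales auto
  define f where "f x = (case x of Spine i \<Rightarrow> Suc i | Branch i j \<Rightarrow> if i = 1 then 1 else n)" for x
  have f: "f (Spine i) = Suc i" "f (Branch 1 1) = 1" "f (Branch 2 1) = n" for i by (simp_all add: f_def)
  have branches: "(\<lambda>(i, j). Branch i j) ` ({1..1 + 1} \<times> {1..1}) = {Branch 1 1, Branch 2 1}"
    by (auto simp: numeral_2_eq_2 le_Suc_eq image_iff)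
  have verts: "verts A.A = Spine ` {1..n - 2} \<union> {Branch 1 1, Branch 2 1}"
    unfolding A.verts_eq branches by simp
  have surj: "f ` verts A.A = verts (path_graph n)"
  proof -
    have "f ` verts A.A = Suc ` {1..n - 2} \<union> {1, n}"
      unfolding verts image_Un image_image by (simp add: f_def)
    also have "Suc ` {1..n - 2} = {2..n - 1}"
    proof -
      have "Suc (n - 2) = n - 1" using assms by simp
      then show ?thesis unfolding image_Suc_atLeastAtMost by (simp add: numeral_2_eq_2)
    qed
    also have "{2..n - 1} \<union> {1, n} = {1..n}" using assms by auto
    finally show ?thesis by (simp add: path_graph_def)
  qed
  have "card (verts A.A) = card (verts (path_graph n))"
    using A.card_verts_A by (simp add: path_graph_def)
  then have inj: "inj_on f (verts A.A)" using surj A.fin by (intro eq_card_imp_inj_on) simp_all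
  have path_edge: "{i, Suc i} \<in> edges (path_graph n)" if "1 \<le> i" "Suc i \<le> n" for i
    using that unfolding path_graph_def by auto
  have "(`) f ` edges A.A = edges (path_graph n)"
  proof (intro equalityI subsetI)
    fix e
    assume "e \<in> (`) f ` edges A.A"
    then obtain v where v: "v \<in> verts A.A" "v \<noteq> Spine (n - 2)" "e = {f v, f (A_parent 1 (n - 2) v)}"
      unfolding A.edges_image by auto
    then consider i where "v = Spine i" "1 \<le> i" "i < n - 2" | "v = Branch 1 1" | "v = Branch 2 1"
      unfolding verts by fastforce
    then show "e \<in> edges (path_graph n)"
    proof cases
      case 1
      then have "e = {Suc i, Suc (Suc i)}" using v(3) by (simp add: f_def)
      then show ?thesis using path_edge[of "Suc i"] 1 by simp
    next
      case 2
      then have "e = {1, Suc 1}" using v(3) by (simp add: f_def)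
      then show ?thesis using path_edge[of 1] assms by simp
    next
      case 3
      moreover have "Suc (n - 2) = n - 1" "Suc (n - 1) = n" using assms by simp_all
      ultimately have "e = {n - 1, Suc (n - 1)}" using v(3) by (simp add: f_def insert_commute)
      then show ?thesis using path_edge[of "n - 1"] assms by simp
    qed
  next
    fix e
    assume "e \<in> edges (path_graph n)"
    then obtain i where i: "1 \<le> i" "Suc i \<le> n" "e = {i, Suc i}" unfolding path_graph_def by auto
    have "\<exists>v. v \<in> verts A.A \<and> v \<noteq> Spine (n - 2) \<and> e = f ` {v, A_parent 1 (n - 2) v}"
    proof -
      consider "i = 1" | "Suc i = n" | "2 \<le> i" "Suc i < n" using i by linarith
      then show ?thesis
      proof cases
        case 1
        then show ?thesis using i(3) verts by (intro exI[of _ "Branch 1 1"]) (simp add: f_def)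
      next
        case 2
        then have "Suc (n - 2) = i" using assms by simp
        then show ?thesis using i(3) 2 verts
          by (intro exI[of _ "Branch 2 1"]) (simp add: f_def insert_commute)
      next
        case 3
        then show ?thesis using i(3) verts
          by (intro exI[of _ "Spine (i - 1)"]) (auto simp: f_def)
      qed
    qed
    then show "e \<in> (`) f ` edges A.A" using A.parent_edge by blast
  qed
  then show ?thesis by (rule graph_isoI[OF A.simple inj surj])
qed

text \<open>\<open>P\<close> is any selection of \<open>a + b\<close> pendent paths of one length,
  so (i) and (ii) can use it with length 1 although their trees are specified by paths of length
  \<open>r\<close>. Rooting at an end of the core makes the selected paths ascend and gives the root
  at most one core child.\<close>

lemma extremal_tree:
  assumes tree: "is_tree G" and n: "card (verts G) = n"
    and P: "P \<subseteq> pendent_paths G r" "card P = a + b"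
    and ab: "1 \<le> b" "b \<le> a" "a \<le> b + 1" and r: "1 \<le> r" "(a + b) * r + 1 \<le> n"
    and le: "mostar_index G \<le> mostar_index (A_graph r n a b)"
  shows "G \<cong>\<^sub>g A_graph r n a b"
proof -
  have fin: "finite (verts G)" using tree by (auto simp: is_tree_def simple_graph_def)
  have finP: "finite P" using P(1) finite_pendent_paths[OF fin] finite_subset by blast
  \<comment> \<open>The path vertices without the points of attachment. By the bound on
    \<open>n\<close> they do not exhaust the tree, so the core is nonempty and has an end.\<close>
  define Y where "Y = (\<Union>us\<in>P. set (take r us))"
  have "card Y \<le> (\<Sum>us\<in>P. card (set (take r us)))" unfolding Y_def by (rule card_UN_le[OF finP])
  also have "\<dots> \<le> (\<Sum>us\<in>P. r)"
  proof (rule sum_mono)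
    fix us
    show "card (set (take r us)) \<le> r" using card_length[of "take r us"] by simp
  qed
  also have "\<dots> = (a + b) * r" using P(2) by simp
  finally have "card Y < card (verts G)" using r(2) n by simp
  moreover have "finite Y" unfolding Y_def using finP by simp
  ultimately have "verts G - Y \<noteq> {}" using card_mono[of Y "verts G"] by auto
  then obtain c where c: "c \<in> verts G - Y"
    and end_c: "\<And>x y. x \<in> verts G - Y \<Longrightarrow> y \<in> verts G - Y \<Longrightarrow> {c, x} \<in> edges G \<Longrightarrow> {c, y} \<in> edges G \<Longrightarrow> x = y"
    using tree_end_in_subset[OF tree, of "verts G - Y"] by blast
  obtain p h where "rooted_tree G c p h" using rooted_tree_exists[OF tree] c by blast
  then interpret rooted_tree G c p h .
  have up: "us ! i = (p ^^ i) (hd us) \<and> us ! i \<noteq> c \<and> card (D (us ! i)) = Suc i"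
    if "us \<in> P" "i < r" for us i
  proof -
    have us: "us \<in> pendent_paths G r" "c \<notin> set (take r us)" using that P(1) c by (auto simp: Y_def)
    show ?thesis
      using pendent_path_ascends[OF us, of i] that(2) pendent_pathsD(5)[OF us(1)] by simp
  qed
  interpret rooted_tree_with_paths G c p h "hd ` P" r
  proof
    show "hd ` P \<subseteq> verts G"
    proof (rule image_subsetI)
      fix us
      assume "us \<in> P"
      then have "us \<in> pendent_paths G r" using P(1) by blast
      then show "hd us \<in> verts G" using pendent_pathsD(5,11)[of us G r] by simp
    qed
    fix l i
    assume "l \<in> hd ` P" "i < r"
    then obtain us where "us \<in> P" "l = hd us" by blast
    then show "(p ^^ i) l \<noteq> c" "card (D ((p ^^ i) l)) = Suc i"
      using up[OF _ \<open>i < r\<close>, of us] by metis+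
  qed (rule r(1))
  have "Y \<subseteq> Hang"
  proof
    fix x
    assume "x \<in> Y"
    then obtain us i where "us \<in> P" "i < r" "x = us ! i"
      using P(1) by (auto simp: Y_def in_set_conv_nth)
    then show "x \<in> Hang" using up[of us i] HangI[of "hd us" i] by auto
  qed
  then have WY: "W \<subseteq> verts G - Y" by (auto simp: W_def)
  have end_root: "x = y" if "x \<in> W - {c}" "y \<in> W - {c}" "p x = c" "p y = c" for x y
    using end_c[of x y] that WY parent_edge[of x] parent_edge[of y] by (auto simp: insert_commute)
  have cardL: "card (hd ` P) = a + b"
    using P(2) card_image[OF inj_on_subset[OF inj_on_hd_pendent_paths P(1)]] by simp
  obtain v L1 L2 where v: "v \<in> W" "\<forall>w\<in>W. v \<in> D w" "L1 \<union> L2 = hd ` P" "L1 \<inter> L2 = {}"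
    "\<forall>l\<in>L1. (p ^^ r) l = c" "\<forall>l\<in>L2. (p ^^ r) l = v"
    "card L1 = a \<and> card L2 = b \<or> card L1 = b \<and> card L2 = a"
    using mostar_le_imp_chain[OF cardL ab(2,3,1) end_root n le] by blast
  interpret A: A_tree r n a b "n - (a + b) * r" using r by unfold_locales linarith+
  interpret B: A_tree r n b a "n - (b + a) * r"
    using r unfolding add.commute[of a b] by unfold_locales linarith+
  \<comment> \<open>The rooting does not determine which end carries the \<open>a\<close> paths, so
    both orders of the parameters arise.\<close>
  from v(7) show ?thesis
  proof
    assume "card L1 = a \<and> card L2 = b"
    then show ?thesis using v n A.simple by (intro chain_iso_A_graph[of v L1 L2]) auto
  next
    assume "card L1 = b \<and> card L2 = a"
    then have "G \<cong>\<^sub>g A_graph r n b a" using v n B.simple by (intro chain_iso_A_graph[of v L1 L2]) auto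
    then show ?thesis using B.A_graph_swap graph_iso_trans by blast
  qed
qed

text \<open>Needed because minimality compares \<open>T\<close> only with trees on its own vertex
  type. The graph \<open>H\<close> just provides a vertex set of the right size in that
  type.\<close>

lemma tree_copy:
  fixes G :: "'a graph" and H :: "'b graph"
  assumes "is_tree G" "finite (verts H)" "card (verts G) = card (verts H)"
  shows "\<exists>S :: 'b graph. is_tree S \<and> order S = order G \<and> mostar_index S = mostar_index G \<and>
    (\<forall>r. card (pendent_paths S r) = card (pendent_paths G r))"
proof -
  have simple: "simple_graph G" using assms(1) by (simp add: is_tree_def)
  then have "finite (verts G)" by (simp add: simple_graph_def)
  then obtain f where "bij_betw f (verts G) (verts H)"
    using finite_same_card_bij[OF _ assms(2,3)] by blast
  then interpret graph_embedding G f using simple by unfold_locales (simp_all add: bij_betw_def)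
  show ?thesis using is_tree_map[OF assms(1)] order_map mostar_map card_pendent_map by blast
qed

theorem theorem5p2:
  fixes n k r :: nat and T :: "'a graph"
  assumes "n \<ge> 1" and "k \<ge> 1" and "r \<ge> 1"
    and "T \<in> trees_with_pendent_paths n k r"
    and "\<And>S :: 'a graph. S \<in> trees_with_pendent_paths n k r \<Longrightarrow> mostar_index T \<le> mostar_index S"
  shows "(k = 1 \<and> 2 \<le> r \<and> int r \<le> int n - 3 \<longrightarrow> T \<cong>\<^sub>g A_graph 1 n 1 2) \<and>
         (k = 2 \<and> 1 \<le> r \<and> int r \<le> int n - 2 \<longrightarrow> T \<cong>\<^sub>g path_graph n) \<and>
         (k \<ge> 3 \<and> 1 \<le> r \<and> real r \<le> (real n - 2) / real k \<longrightarrow>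
            T \<cong>\<^sub>g A_graph r n (nat \<lceil>real k / 2\<rceil>) (nat \<lfloor>real k / 2\<rfloor>))"
proof -
  have T: "is_tree T" "card (verts T) = n" "card (pendent_paths T r) = k"
    using assms(4) by (auto simp: trees_with_pendent_paths_def order_def)
  have fin: "finite (verts T)" using T(1) by (auto simp: is_tree_def simple_graph_def)
  have le: "mostar_index T \<le> mostar_index A"
    if A: "is_tree A" "card (verts A) = n" "card (pendent_paths A r) = k" for A :: "bvertex graph"
  proof -
    obtain S :: "'a graph" where "is_tree S" "order S = order A" "mostar_index S = mostar_index A"
      "\<forall>r. card (pendent_paths S r) = card (pendent_paths A r)"
      using tree_copy[of A T] A T fin by auto
    then show ?thesis
      using assms(5)[of S] A by (simp add: trees_with_pendent_paths_def order_def)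
  qed
  have i: "T \<cong>\<^sub>g A_graph 1 n 1 2" if "k = 1" "2 \<le> r" "int r \<le> int n - 3"
  proof -
    have rn: "r + 3 \<le> n" using that(3) by linarith
    interpret A: A_tree 1 n 1 2 "n - 3" using rn that(2) by unfold_locales auto
    interpret B: A_tree 1 n 2 1 "n - 3" using rn that(2) by unfold_locales auto
    have "mostar_index T \<le> mostar_index (A_graph 1 n 1 2)"
      using card_pendent_paths_A112[OF that(2) rn] that(1) by (intro le A.is_tree A.card_verts_A) simp
    \<comment> \<open>The extremal statement expects the larger number of paths first, so the
      competitor is taken in its mirrored form.\<close>
    also have "\<dots> = mostar_index (A_graph 1 n 2 1)"
      by (rule mostar_index_iso[OF A.A_graph_swap A.simple B.simple])
    finally have le21: "mostar_index T \<le> mostar_index (A_graph 1 n 2 1)" .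
    \<comment> \<open>From here on \<open>r\<close> matters no more: three leaves serve as the
      selected pendent paths, of length 1.\<close>
    have "2 + 1 \<le> card (pendent_paths T 1)"
      using three_leaves_if_unique_pendent_path[OF T(1), of r] T that rn by simp
    then obtain P where P: "P \<subseteq> pendent_paths T 1" "card P = 2 + 1"
      by (rule obtain_subset_with_card_n)
    have "T \<cong>\<^sub>g A_graph 1 n 2 1"
      by (rule extremal_tree[OF T(1,2) P _ _ _ _ _ le21]) (use rn that(2) in simp_all)
    then show ?thesis using B.A_graph_swap by (rule graph_iso_trans)
  qed
  have ii: "T \<cong>\<^sub>g path_graph n" if "k = 2" "1 \<le> r" "int r \<le> int n - 2"
  proof -
    have rn: "r + 2 \<le> n" using that(3) by linarith
    interpret A: A_tree 1 n 1 1 "n - 2" using rn that(2) by unfold_locales auto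
    have tips: "A.tips = {Branch 1 1, Branch 2 1}"
      unfolding A.tips_def by (auto simp: numeral_2_eq_2 le_Suc_eq image_iff)
    have leaves: "{x \<in> verts A.A. degree A.A x = 1} = {Branch 1 1, Branch 2 1}"
    proof
      show "{x \<in> verts A.A. degree A.A x = 1} \<subseteq> {Branch 1 1, Branch 2 1}"
        using A.leaf_is_tip unfolding tips by blast
      show "{Branch 1 1, Branch 2 1} \<subseteq> {x \<in> verts A.A. degree A.A x = 1}"
        using A.Branch_in[of 1 1] A.Branch_in[of 2 1] A.degree_Branch[of 1 1] A.degree_Branch[of 2 1]
        by simp
    qed
    have "card (pendent_paths A.A r) = 2"
      by (rule card_pendent_paths_two_leaves[OF A.is_tree leaves _ that(2)])
        (use rn in \<open>simp_all only: A.card_verts_A, simp\<close>)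
    then have le11: "mostar_index T \<le> mostar_index (A_graph 1 n 1 1)"
      using that(1) by (intro le A.is_tree A.card_verts_A) simp
    have "1 + 1 \<le> card (pendent_paths T 1)"
      using card_pendent_paths_le[OF finite_pendent_paths[OF fin], of r] T(3) that(1) by simp
    then obtain P where P: "P \<subseteq> pendent_paths T 1" "card P = 1 + 1"
      by (rule obtain_subset_with_card_n)
    have "T \<cong>\<^sub>g A_graph 1 n 1 1"
      by (rule extremal_tree[OF T(1,2) P _ _ _ _ _ le11]) (use rn that(2) in simp_all)
    moreover have "3 \<le> n" using rn that(2) by simp
    ultimately show ?thesis by (blast intro: graph_iso_trans A111_iso_path_graph)
  qed
  have iii: "T \<cong>\<^sub>g A_graph r n (nat \<lceil>real k / 2\<rceil>) (nat \<lfloor>real k / 2\<rfloor>)"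
    if "k \<ge> 3" "1 \<le> r" "real r \<le> (real n - 2) / real k"
  proof -
    define a b where "a = nat \<lceil>real k / 2\<rceil>" and "b = nat \<lfloor>real k / 2\<rfloor>"
    have b: "b = k div 2" unfolding b_def by (simp add: floor_divide_of_nat_eq[of k 2, simplified])
    have "\<lceil>real k / 2\<rceil> = int ((k + 1) div 2)" by (rule ceiling_unique) linarith+
    then have a: "a = (k + 1) div 2" unfolding a_def by simp
    have ab: "a + b = k" "1 \<le> b" "b \<le> a" "a \<le> b + 1" using a b that(1) by linarith+
    have "real (k * r + 2) \<le> real n" using that(1,3) by (simp add: field_simps)
    then have rn: "(a + b) * r + 2 \<le> n" unfolding ab(1) by linarith
    interpret A: A_tree r n a b "n - (a + b) * r" using rn that(2) by unfold_locales auto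
    have le_ab: "mostar_index T \<le> mostar_index (A_graph r n a b)"
      using A.card_pendent_paths_A ab by (intro le A.is_tree A.card_verts_A) simp
    have "card (pendent_paths T r) = a + b" "(a + b) * r + 1 \<le> n" using T(3) ab(1) rn by simp_all
    then have "T \<cong>\<^sub>g A_graph r n a b"
      by (rule extremal_tree[OF T(1,2) order_refl _ ab(2-4) that(2) _ le_ab])
    then show ?thesis by (simp add: a_def b_def)
  qed
  show ?thesis using i ii iii by blast
qed

end
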